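(* Let $\Omega$ be a bounded, causally convex domain in $\mathbf{R}^{1,n}$. If $(\Omega,\delta_\Omega)$ is Gromov hyperbolic, then $\Omega$ is not $C$-maximal.
   Context: Minkowski space: $\mathbf{R}^{1,n}$ ($n\ge 1$) is $\mathbf{R}\times\mathbf{R}^n$ with coordinates $(t,p)$, flat metric $\mathbf{b}=-dt^2+dp_1^2+\dots+dp_n^2$ and time orientation $\partial_t$. A nonzero vector $v$ is lightlike if $\mathbf{b}(v,v)=0$, causal if $\mathbf{b}(v,v)\le 0$; a causal curve is a piecewise smooth curve with future causal (or past causal) velocity. A domain is a nonempty, connected, proper open subset of $\mathbf{R}^{1,n}$. A domain $\Omega$ is causally convex if every causal curve of $\mathbf{R}^{1,n}$ with endpoints in $\Omega$ is contained in $\Omega$. Markowitz pseudodistance: let $I=(-1,1)$ and $\rho_I(s,t)=\left|\ln\frac{(s-1)(t+1)}{(s+1)(t-1)}\right|$. For a domain $\Omega$, a projectively parametrized lightlike geodesic of $\Omega$ is a curve $\gamma:I\to\Omega$, $\gamma(s)=x+h(s)v$, with $v$ lightlike and $h$ a (nonconstant) real homography without pole in $I$. Then $\delta_\Omega(x,y)=\inf\sum_{k=1}^m\rho_I(s_k,t_k)$, the infimum being over all finite families of such geodesics $\gamma_1,\dots,\gamma_m$ and points $s_k,t_k\in I$ with $\gamma_1(s_1)=x$, $\gamma_m(t_m)=y$, $\gamma_k(t_k)=\gamma_{k+1}(s_{k+1})$. $C$-maximality: a conformal spacetime is a manifold with a conformal class of Lorentzian metrics and a time orientation. A Cauchy hypersurface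 is a topological hypersurface meeting every inextensible causal curve exactly once; a conformal spacetime is globally hyperbolic if it admits one (causally convex domains of $\mathbf{R}^{1,n}$, with the conformal class $[\mathbf{b}]$, are globally hyperbolic). A conformal map $f:M\to N$ between globally hyperbolic conformal spacetimes (of the same dimension) is a Cauchy embedding if it maps a Cauchy hypersurface of $M$ to a Cauchy hypersurface of $N$. A globally hyperbolic conformal spacetime $M$ is $C$-maximal if every Cauchy embedding $f:M\to N$ is onto. Gromov hyperbolicity of a proper geodesic metric space means that there is a constant $r>0$ such that each side of every geodesic triangle lies in the $r$-neighborhood of the union of the other two sides. *)

theory Defs
  imports "HOL-Analysis.Analysis"
begin

section \<open>Minkowski space\<close>

text \<open>\<open>(t, p)\<close> with \<open>p :: real ^ 'n\<close>; here \<open>n = CARD('n) \<ge> 1\<close>.\<close>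
type_synonym 'n mink = "real \<times> (real ^ 'n)"

definition mink_form :: "'n::finite mink \<Rightarrow> 'n mink \<Rightarrow> real" where
  "mink_form v w = - (fst v * fst w) + snd v \<bullet> snd w"

definition lightlike :: "'n::finite mink \<Rightarrow> bool" where
  "lightlike v \<longleftrightarrow> v \<noteq> 0 \<and> mink_form v v = 0"

definition mink_domain :: "'n::finite mink set \<Rightarrow> bool" where
  "mink_domain \<Omega> \<longleftrightarrow> open \<Omega> \<and> connected \<Omega> \<and> \<Omega> \<noteq> {} \<and> \<Omega> \<noteq> UNIV"


section \<open>Smooth maps\<close>

primrec Ck_on :: "nat \<Rightarrow> 'a::euclidean_space set \<Rightarrow> ('a \<Rightarrow> 'b::euclidean_space) \<Rightarrow> bool" where
  "Ck_on 0 S f \<longleftrightarrow> continuous_on S f"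
| "Ck_on (Suc k) S f \<longleftrightarrow>
     (\<forall>x\<in>S. f differentiable (at x)) \<and> (\<forall>v. Ck_on k S (\<lambda>x. frechet_derivative f (at x) v))"

text \<open>Only used for open \<open>S\<close>.\<close>
definition smooth_on :: "'a::euclidean_space set \<Rightarrow> ('a \<Rightarrow> 'b::euclidean_space) \<Rightarrow> bool" where
  "smooth_on S f \<longleftrightarrow> (\<forall>k. Ck_on k S f)"


section \<open>Conformal spacetimes\<close>

text \<open>
  A chart is a pair \<open>(U, \<phi>)\<close>, with \<open>\<phi>\<close> mapping \<open>U\<close> onto an open subset of the model space
  \<open>\<real> \<times> \<real>\<^sup>n\<close>. Tensor fields are families of local expressions, one for each chart of the
  atlas and evaluated at a point of the image of that chart: \<open>lmetric M c x v w\<close> is the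
  metric and \<open>tvec M c x\<close> a timelike vector field.

  The conformal class and the time orientation are given by representatives: a metric \<open>g\<close>, up
  to multiplication by positive functions, and a timelike vector field \<open>T\<close>, up to the choice of
  another one in the same cones. No notion below depends on these choices.
\<close>
type_synonym ('a, 'n) chart = "'a set \<times> ('a \<Rightarrow> 'n mink)"

record ('a, 'n) spacetime =
  topo :: "'a topology"
  atlas :: "('a, 'n) chart set"
  lmetric :: "('a, 'n) chart \<Rightarrow> 'n mink \<Rightarrow> 'n mink \<Rightarrow> 'n mink \<Rightarrow> real"
  tvec :: "('a, 'n) chart \<Rightarrow> 'n mink \<Rightarrow> 'n mink"

abbreviation points :: "('a, 'n) spacetime \<Rightarrow> 'a set" where
  "points M \<equiv> topspace (topo M)"

text \<open>The local expression of \<open>f\<close>; for \<open>f = id\<close> this is a transition map.\<close>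
definition in_charts :: "('a, 'n) chart \<Rightarrow> ('b, 'n) chart \<Rightarrow> ('a \<Rightarrow> 'b) \<Rightarrow> 'n mink \<Rightarrow> 'n mink" where
  "in_charts c d f = snd d \<circ> f \<circ> inv_into (fst c) (snd c)"

definition smooth_manifold :: "('a, 'n::finite) spacetime \<Rightarrow> bool" where
  "smooth_manifold M \<longleftrightarrow>
     Hausdorff_space (topo M) \<and> second_countable (topo M) \<and>
     points M = (\<Union>c\<in>atlas M. fst c) \<and>
     (\<forall>c\<in>atlas M. openin (topo M) (fst c) \<and> open (snd c ` fst c) \<and>
        homeomorphic_map (subtopology (topo M) (fst c)) (top_of_set (snd c ` fst c)) (snd c)) \<and>
     (\<forall>c\<in>atlas M. \<forall>d\<in>atlas M. smooth_on (snd c ` (fst c \<inter> fst d)) (in_charts c d id))"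

text \<open>Symmetric bilinear forms of signature \<open>(-,+,\<dots>,+)\<close>.\<close>
definition lorentz_form :: "('n::finite mink \<Rightarrow> 'n mink \<Rightarrow> real) \<Rightarrow> bool" where
  "lorentz_form B \<longleftrightarrow> (\<exists>A :: 'n mink \<Rightarrow> 'n mink. linear A \<and> bij A \<and> (\<forall>v w. B v w = mink_form (A v) (A w)))"

definition conformal_spacetime :: "('a, 'n::finite) spacetime \<Rightarrow> bool" where
  "conformal_spacetime M \<longleftrightarrow>
     smooth_manifold M \<and>
     (\<forall>c\<in>atlas M.
        (\<forall>x\<in>snd c ` fst c. lorentz_form (lmetric M c x)
           \<and> lmetric M c x (tvec M c x) (tvec M c x) < 0) \<and>
        (\<forall>v w. smooth_on (snd c ` fst c) (\<lambda>x. lmetric M c x v w)) \<and>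
        continuous_on (snd c ` fst c) (tvec M c)) \<and>
     (\<forall>c\<in>atlas M. \<forall>d\<in>atlas M. \<forall>p\<in>fst c \<inter> fst d.
        let D = frechet_derivative (in_charts c d id) (at (snd c p)) in
          (\<forall>v w. lmetric M c (snd c p) v w = lmetric M d (snd d p) (D v) (D w)) \<and>
          tvec M d (snd d p) = D (tvec M c (snd c p)))"

text \<open>An open subset of Minkowski space, with its flat metric and the time orientation
  \<open>\<partial>\<^sub>t\<close>.\<close>
definition mink_spacetime :: "'n::finite mink set \<Rightarrow> ('n mink, 'n) spacetime" where
  "mink_spacetime \<Omega> =
     \<lparr>topo = top_of_set \<Omega>, atlas = {(\<Omega>, id)}, lmetric = (\<lambda>c x. mink_form), tvec = (\<lambda>c x. (1, 0))\<rparr>"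


section \<open>Causal curves\<close>

definition future_cone :: "('a, 'n::finite) spacetime \<Rightarrow> ('a, 'n) chart \<Rightarrow> 'n mink \<Rightarrow> 'n mink set" where
  "future_cone M c x = {v. v \<noteq> 0 \<and> lmetric M c x v v \<le> 0 \<and> lmetric M c x v (tvec M c x) < 0}"

definition past_cone :: "('a, 'n::finite) spacetime \<Rightarrow> ('a, 'n) chart \<Rightarrow> 'n mink \<Rightarrow> 'n mink set" where
  "past_cone M c x = {v. v \<noteq> 0 \<and> lmetric M c x v v \<le> 0 \<and> lmetric M c x v (tvec M c x) > 0}"

text \<open>
  A smooth curve on the closed interval \<open>{a..b}\<close>, that is, near every parameter the restriction
  to \<open>{a..b}\<close> of a curve \<open>\<kappa>\<close> (in a chart) smooth on an open set, with all velocities in the cone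
  field \<open>C\<close>. As \<open>a < b\<close>, the velocity does not depend on \<open>\<kappa>\<close>, even at the end points.
\<close>
definition smooth_arc ::
  "('a, 'n::finite) spacetime \<Rightarrow> (('a, 'n) chart \<Rightarrow> 'n mink \<Rightarrow> 'n mink set) \<Rightarrow> (real \<Rightarrow> 'a) \<Rightarrow> real \<Rightarrow> real \<Rightarrow> bool" where
  "smooth_arc M C \<gamma> a b \<longleftrightarrow>
     a < b \<and>
     (\<forall>s\<in>{a..b}. \<gamma> s \<in> points M \<and>
        (\<forall>c\<in>atlas M. \<gamma> s \<in> fst c \<longrightarrow>
           (\<exists>V \<kappa>. open V \<and> s \<in> V \<and> \<gamma> ` (V \<inter> {a..b}) \<subseteq> fst c \<and> smooth_on V \<kappa> \<and>
              (\<forall>u\<in>V \<inter> {a..b}. \<kappa> u = snd c (\<gamma> u)) \<and>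
              vector_derivative \<kappa> (at s) \<in> C c (snd c (\<gamma> s)))))"

inductive piecewise_smooth_arc ::
  "('a, 'n::finite) spacetime \<Rightarrow> (('a, 'n) chart \<Rightarrow> 'n mink \<Rightarrow> 'n mink set) \<Rightarrow> (real \<Rightarrow> 'a) \<Rightarrow> real \<Rightarrow> real \<Rightarrow> bool"
  for M C \<gamma> where
  smooth: "smooth_arc M C \<gamma> a b \<Longrightarrow> piecewise_smooth_arc M C \<gamma> a b"
| join: "piecewise_smooth_arc M C \<gamma> a m \<Longrightarrow> piecewise_smooth_arc M C \<gamma> m b \<Longrightarrow> piecewise_smooth_arc M C \<gamma> a b"

definition causal_arc :: "('a, 'n::finite) spacetime \<Rightarrow> (real \<Rightarrow> 'a) \<Rightarrow> real \<Rightarrow> real \<Rightarrow> bool" where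
  "causal_arc M \<gamma> a b \<longleftrightarrow>
     piecewise_smooth_arc M (future_cone M) \<gamma> a b \<or> piecewise_smooth_arc M (past_cone M) \<gamma> a b"

definition causally_convex :: "'n::finite mink set \<Rightarrow> bool" where
  "causally_convex \<Omega> \<longleftrightarrow>
     (\<forall>\<gamma> a b. causal_arc (mink_spacetime UNIV) \<gamma> a b \<and> \<gamma> a \<in> \<Omega> \<and> \<gamma> b \<in> \<Omega> \<longrightarrow> \<gamma> ` {a..b} \<subseteq> \<Omega>)"

text \<open>
  Inextensible: no end point in \<open>M\<close>, neither in the future nor in the past. Such a curve is
  defined on an open interval, which is taken to be \<open>\<real>\<close> after a reparametrization.
\<close>
definition inextensible_causal_curve :: "('a, 'n::finite) spacetime \<Rightarrow> (real \<Rightarrow> 'a) \<Rightarrow> bool" where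
  "inextensible_causal_curve M \<gamma> \<longleftrightarrow>
     ((\<forall>a b. a < b \<longrightarrow> piecewise_smooth_arc M (future_cone M) \<gamma> a b) \<or>
      (\<forall>a b. a < b \<longrightarrow> piecewise_smooth_arc M (past_cone M) \<gamma> a b)) \<and>
     (\<nexists>p. limitin (topo M) \<gamma> p at_top) \<and> (\<nexists>p. limitin (topo M) \<gamma> p at_bot)"


section \<open>Global hyperbolicity and \<open>C\<close>-maximality\<close>

text \<open>Embedded codimension one topological submanifolds (O'Neill's definition).\<close>
definition topological_hypersurface :: "('a, 'n::finite) spacetime \<Rightarrow> 'a set \<Rightarrow> bool" where
  "topological_hypersurface M S \<longleftrightarrow>
     S \<subseteq> points M \<and>
     (\<forall>p\<in>S. \<exists>U (W :: 'n mink set) \<phi>. openin (topo M) U \<and> p \<in> U \<and> open W \<and>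
        homeomorphic_map (subtopology (topo M) U) (top_of_set W) \<phi> \<and>
        \<phi> ` (U \<inter> S) = {x \<in> W. fst x = 0})"

definition cauchy_hypersurface :: "('a, 'n::finite) spacetime \<Rightarrow> 'a set \<Rightarrow> bool" where
  "cauchy_hypersurface M S \<longleftrightarrow>
     topological_hypersurface M S \<and> (\<forall>\<gamma>. inextensible_causal_curve M \<gamma> \<longrightarrow> (\<exists>!s. \<gamma> s \<in> S))"

definition globally_hyperbolic :: "('a, 'n::finite) spacetime \<Rightarrow> bool" where
  "globally_hyperbolic M \<longleftrightarrow> conformal_spacetime M \<and> (\<exists>S. cauchy_hypersurface M S)"

text \<open>
  Smooth maps pulling back the conformal class and the time orientation of \<open>N\<close> to those of
  \<open>M\<close>. The factor \<open>l\<close> depends on the point; it is automatically a smooth function.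
\<close>
definition conformal_map :: "('a, 'n::finite) spacetime \<Rightarrow> ('b, 'n) spacetime \<Rightarrow> ('a \<Rightarrow> 'b) \<Rightarrow> bool" where
  "conformal_map M N f \<longleftrightarrow>
     f ` points M \<subseteq> points N \<and>
     (\<forall>c\<in>atlas M. \<forall>d\<in>atlas N. \<forall>p\<in>fst c. f p \<in> fst d \<longrightarrow>
        (let x = snd c p; y = snd d (f p); F = in_charts c d f; D = frechet_derivative F (at x) in
          (\<exists>W. openin (topo M) W \<and> p \<in> W \<and> W \<subseteq> fst c \<and> f ` W \<subseteq> fst d \<and> smooth_on (snd c ` W) F) \<and>
          (\<exists>l>0. \<forall>v w. lmetric N d y (D v) (D w) = l * lmetric M c x v w) \<and>
          D (tvec M c x) \<in> future_cone N d y))"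

text \<open>
  Injectivity is part of being an embedding and cannot be dropped: for \<open>n = 1\<close> and \<open>a < 2 r\<close> the
  projection of the diamond \<open>|t| + |p| < r\<close> to the cylinder \<open>\<real> \<times> (\<real>/a\<int>)\<close> is locally
  conformal, is not onto, and maps the Cauchy hypersurface \<open>t = 0\<close> onto the Cauchy hypersurface
  \<open>t = 0\<close>, although the diamond has no proper Cauchy extension.
\<close>
definition cauchy_embedding :: "('a, 'n::finite) spacetime \<Rightarrow> ('b, 'n) spacetime \<Rightarrow> ('a \<Rightarrow> 'b) \<Rightarrow> bool" where
  "cauchy_embedding M N f \<longleftrightarrow>
     conformal_map M N f \<and> inj_on f (points M) \<and>
     (\<exists>S. cauchy_hypersurface M S \<and> cauchy_hypersurface N (f ` S))"

text \<open>
  For globally hyperbolic \<open>M\<close>. The points of \<open>N\<close> range over the type \<open>'a\<close> of the points of \<open>M\<close>.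
  For \<open>'a = 'n mink\<close> this is no restriction: \<open>N\<close> is a second countable Hausdorff manifold, hence
  has at most the cardinality of the continuum and is isomorphic to a spacetime carried by a
  subset of \<open>'n mink\<close>.
\<close>
definition C_maximal :: "('a, 'n::finite) spacetime \<Rightarrow> bool" where
  "C_maximal M \<longleftrightarrow>
     (\<forall>(N :: ('a, 'n) spacetime) f.
        globally_hyperbolic N \<and> cauchy_embedding M N f \<longrightarrow> f ` points M = points N)"


section \<open>The Markowitz pseudodistance\<close>

definition rho :: "real \<Rightarrow> real \<Rightarrow> real" where
  "rho s t = \<bar>ln (((s - 1) * (t + 1)) / ((s + 1) * (t - 1)))\<bar>"

definition proj_lightlike_geodesic :: "'n::finite mink set \<Rightarrow> (real \<Rightarrow> 'n mink) \<Rightarrow> bool" where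
  "proj_lightlike_geodesic \<Omega> \<gamma> \<longleftrightarrow>
     (\<exists>x v a b c d. lightlike v \<and> a * d - b * c \<noteq> 0 \<and>
        (\<forall>s\<in>{-1<..<1}. c * s + d \<noteq> 0 \<and>
           \<gamma> s = x + ((a * s + b) / (c * s + d)) *\<^sub>R v \<and> \<gamma> s \<in> \<Omega>))"

text \<open>
  In a domain, which is open and connected, any two points are joined by a chain, so the infimum
  is over a nonempty set of nonnegative numbers. The value off \<open>\<Omega>\<close> is irrelevant; it is \<open>0\<close>
  because \<open>Metric_space\<close> asks for nonnegativity and symmetry on the whole type.
\<close>
definition markowitz :: "'n::finite mink set \<Rightarrow> 'n mink \<Rightarrow> 'n mink \<Rightarrow> real" where
  "markowitz \<Omega> x y =
     (if x \<in> \<Omega> \<and> y \<in> \<Omega> then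
        Inf {(\<Sum>k=1..m. rho (s k) (t k)) | m \<gamma> s t. m \<ge> (1::nat) \<and>
               (\<forall>k\<in>{1..m}. proj_lightlike_geodesic \<Omega> (\<gamma> k) \<and> s k \<in> {-1<..<1} \<and> t k \<in> {-1<..<1}) \<and>
               \<gamma> 1 (s 1) = x \<and> \<gamma> m (t m) = y \<and>
               (\<forall>k\<in>{1..<m}. \<gamma> k (t k) = \<gamma> (Suc k) (s (Suc k)))}
      else 0)"


section \<open>Gromov hyperbolicity\<close>

definition geodesic_segment :: "'a set \<Rightarrow> ('a \<Rightarrow> 'a \<Rightarrow> real) \<Rightarrow> 'a \<Rightarrow> 'a \<Rightarrow> 'a set \<Rightarrow> bool" where
  "geodesic_segment X d x y A \<longleftrightarrow>
     A \<subseteq> X \<and>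
     (\<exists>\<sigma>. \<sigma> 0 = x \<and> \<sigma> (d x y) = y \<and> A = \<sigma> ` {0..d x y} \<and>
        (\<forall>s\<in>{0..d x y}. \<forall>t\<in>{0..d x y}. d (\<sigma> s) (\<sigma> t) = \<bar>s - t\<bar>))"

definition proper_geodesic_space :: "'a set \<Rightarrow> ('a \<Rightarrow> 'a \<Rightarrow> real) \<Rightarrow> bool" where
  "proper_geodesic_space X d \<longleftrightarrow>
     Metric_space X d \<and>
     (\<forall>x\<in>X. \<forall>r. compactin (Metric_space.mtopology X d) (Metric_space.mcball X d x r)) \<and>
     (\<forall>x\<in>X. \<forall>y\<in>X. \<exists>A. geodesic_segment X d x y A)"

definition in_nbhd :: "('a \<Rightarrow> 'a \<Rightarrow> real) \<Rightarrow> real \<Rightarrow> 'a set \<Rightarrow> 'a set \<Rightarrow> bool" where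
  "in_nbhd d r A B \<longleftrightarrow> (\<forall>p\<in>A. \<exists>q\<in>B. d p q < r)"

definition Gromov_hyperbolic :: "'a set \<Rightarrow> ('a \<Rightarrow> 'a \<Rightarrow> real) \<Rightarrow> bool" where
  "Gromov_hyperbolic X d \<longleftrightarrow>
     proper_geodesic_space X d \<and>
     (\<exists>r>0. \<forall>x\<in>X. \<forall>y\<in>X. \<forall>z\<in>X. \<forall>A B C.
        geodesic_segment X d y z A \<and> geodesic_segment X d z x B \<and> geodesic_segment X d x y C \<longrightarrow>
        in_nbhd d r A (B \<union> C) \<and> in_nbhd d r B (C \<union> A) \<and> in_nbhd d r C (A \<union> B))"

end

theory Submission
  imports Defs "HOL-Real_Asymp.Real_Asymp"
begin

text \<open>
  Let \<open>Q(v)\<close> be the Minkowski square of \<open>v\<close> and let \<open>(a, b)\<close> be a pair of points of the closure of \<open>\<Omega>\<close>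
  at maximal timelike distance, \<open>a\<close> in the past of \<open>b\<close>. If \<open>\<Omega>\<close> is \<open>C\<close>-maximal, then \<open>b\<close> lies on a
  lightlike segment starting at a point \<open>q\<close> that is causally related to no point of
  \<open>\<Omega>\<close>: otherwise \<open>\<Omega>\<close> could be enlarged near \<open>b\<close> without changing its Cauchy hypersurface.

  A function \<open>x \<mapsto> Q(x - p) + const\<close> is affine along lightlike lines, so if it is positive on
  \<open>\<Omega>\<close>, then its logarithm is \<open>1\<close>-Lipschitz for the Markowitz distance. This applies to
  \<open>f(x) = Q(x - q)\<close> and to \<open>h(x) = Q(x - a) - Q(b - a)\<close>. Let \<open>u = b - q\<close>
  and let \<open>w\<close> be another future lightlike vector. In the coordinates
  \<open>(\<tau>, \<epsilon>) \<mapsto> b - \<tau> u - \<epsilon> w\<close>, whose axes are lightlike, \<open>f\<close> is comparable to \<open>\<epsilon>\<close> and \<open>h\<close> to \<open>\<tau>\<close> when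
  \<open>\<epsilon> \<le> \<tau>\<close>. Hence \<open>(- ln \<tau>, - ln \<epsilon>)\<close> identifies up to bounded error a sector of the Euclidean plane
  with a part of \<open>\<Omega>\<close>. Such a sector contains arbitrarily large squares, which do not exist in a
  Gromov hyperbolic space.
\<close>


section \<open>Gromov hyperbolic spaces contain no large squares\<close>

lemma geodesic_segment_sym:
  assumes "Metric_space X d" "geodesic_segment X d x y A"
  shows "geodesic_segment X d y x A"
proof -
  interpret Metric_space X d by fact
  obtain \<sigma> where s: "\<sigma> 0 = x" "\<sigma> (d x y) = y" "A = \<sigma> ` {0..d x y}" "A \<subseteq> X"
    and iso: "\<And>s t. s \<in> {0..d x y} \<Longrightarrow> t \<in> {0..d x y} \<Longrightarrow> d (\<sigma> s) (\<sigma> t) = \<bar>s - t\<bar>"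
    using assms(2) unfolding geodesic_segment_def by blast
  have c: "d y x = d x y" by (rule commute)
  have "A = (\<lambda>s. \<sigma> (d x y - s)) ` {0..d x y}"
    unfolding s(3) by (force simp: image_iff intro: bexI[of _ "d x y - _"])
  then show ?thesis
    unfolding geodesic_segment_def c using s
    by (intro conjI exI[of _ "\<lambda>s. \<sigma> (d x y - s)"]) (auto simp: iso)
qed

lemma geodesic_segment_dist_le:
  assumes "Metric_space X d" "geodesic_segment X d x y A" "p \<in> A"
  shows "d p x \<le> d x y"
proof -
  interpret Metric_space X d by fact
  obtain \<sigma> where s: "\<sigma> 0 = x" "A = \<sigma> ` {0..d x y}"
    and iso: "\<And>s t. s \<in> {0..d x y} \<Longrightarrow> t \<in> {0..d x y} \<Longrightarrow> d (\<sigma> s) (\<sigma> t) = \<bar>s - t\<bar>"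
    using assms(2) unfolding geodesic_segment_def by blast
  obtain s' where "s' \<in> {0..d x y}" "p = \<sigma> s'" using assms(3) s(2) by blast
  then show ?thesis using iso[of s' 0] s(1) by auto
qed

text \<open>Bisect the chain at \<open>x m\<close>: thinness of the triangle with vertices
  \<open>x 0\<close>, \<open>x m\<close>, \<open>x N\<close> moves \<open>p\<close>, at the cost of
  \<open>r\<close>, to a side spanning at most \<open>2 ^ k\<close> of the at most
  \<open>2 ^ Suc k\<close> steps. A side spanning one step has length at most \<open>D\<close>. So
  the error is only logarithmic in the number of steps.\<close>

lemma geodesic_near_chain:
  fixes x :: "nat \<Rightarrow> 'a"
  assumes met: "Metric_space X d" and r: "0 \<le> r" and D: "0 \<le> D"
    and geod: "\<And>x y. x \<in> X \<Longrightarrow> y \<in> X \<Longrightarrow> \<exists>A. geodesic_segment X d x y A"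
    and thin: "\<And>x y z A B C. \<lbrakk>x \<in> X; y \<in> X; z \<in> X; geodesic_segment X d y z A;
        geodesic_segment X d z x B; geodesic_segment X d x y C\<rbrakk> \<Longrightarrow> in_nbhd d r A (B \<union> C)"
    and "N \<le> 2 ^ k" "\<And>i. i \<le> N \<Longrightarrow> x i \<in> X" "\<And>i. i < N \<Longrightarrow> d (x i) (x (Suc i)) \<le> D"
    and "geodesic_segment X d (x 0) (x N) A" "p \<in> A"
  shows "\<exists>i\<le>N. d p (x i) \<le> real k * r + D"
  using assms(6-)
proof (induction k arbitrary: N x A p)
  case 0
  interpret Metric_space X d by fact
  have "d (x 0) (x N) \<le> D"
    using 0(1) 0(2)[of 0] 0(3)[of 0] D by (cases N) (auto simp: mdist_zero)
  then show ?case using geodesic_segment_dist_le[OF met 0(4,5)] by force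
next
  case (Suc k)
  interpret Metric_space X d by fact
  define m where "m = min N (2 ^ k)"
  have m: "m \<le> N" "m \<le> 2 ^ k" "N - m \<le> 2 ^ k" using Suc.prems(1) by (auto simp: m_def)
  have X: "x 0 \<in> X" "x m \<in> X" "x N \<in> X" using Suc.prems(2) m by auto
  obtain B C where B: "geodesic_segment X d (x m) (x N) B" and C: "geodesic_segment X d (x 0) (x m) C"
    using geod X by meson
  have "in_nbhd d r A (B \<union> C)"
    using thin[OF X(2,1,3) Suc.prems(4)] geodesic_segment_sym[OF met] B C by blast
  then obtain q where q: "q \<in> B \<union> C" "d p q < r" using Suc.prems(5) unfolding in_nbhd_def by blast
  have inX: "p \<in> X" "q \<in> X" using q(1) Suc.prems(4,5) B C unfolding geodesic_segment_def by auto
  have "\<exists>i\<le>N. d q (x i) \<le> real k * r + D"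
  proof (cases "q \<in> C")
    case True
    have "\<exists>i\<le>m. d q (x i) \<le> real k * r + D"
      by (rule Suc.IH[OF _ _ _ C True]) (use m Suc.prems in auto)
    then show ?thesis using m(1) le_trans by blast
  next
    case False
    then have "q \<in> B" using q by auto
    have "\<exists>i\<le>N-m. d q (x (m + i)) \<le> real k * r + D"
      by (rule Suc.IH[OF _ _ _ _ \<open>q \<in> B\<close>]) (use m Suc.prems B in auto)
    then obtain i where "i \<le> N - m" "d q (x (m + i)) \<le> real k * r + D" by blast
    then show ?thesis using m by (intro exI[of _ "m + i"]) auto
  qed
  then obtain i where i: "i \<le> N" "d q (x i) \<le> real k * r + D" by blast
  have "d p (x i) \<le> d p q + d q (x i)" using triangle inX i Suc.prems(2) by auto
  then show ?case using i q(2) by (intro exI[of _ i]) (auto simp: algebra_simps)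
qed

lemma chain_dist_le:
  assumes met: "Metric_space X d"
    and "\<And>i. i \<le> N \<Longrightarrow> x i \<in> X" "\<And>i. i < N \<Longrightarrow> d (x i) (x (Suc i)) \<le> D" "i + j \<le> N"
  shows "d (x i) (x (i + j)) \<le> real j * D"
  using assms(4)
proof (induction j)
  case 0
  interpret Metric_space X d by fact
  show ?case using 0 assms(2)[of i] by simp
next
  case (Suc j)
  interpret Metric_space X d by fact
  have "d (x i) (x (i + Suc j)) \<le> d (x i) (x (i + j)) + d (x (i + j)) (x (Suc (i + j)))"
    using triangle assms(2) Suc.prems by auto
  then show ?case using Suc assms(3)[of "i + j"] by (auto simp: algebra_simps)
qed

lemma ex_pow2_gt_linear: "\<exists>k. A * real k + B < 2 ^ k"
proof -
  have "(\<lambda>k. (A * real k + B) / 2 ^ k) \<longlonglongrightarrow> 0" by real_asymp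
  then have "eventually (\<lambda>k. (A * real k + B) / 2 ^ k < 1) sequentially"
    by (rule order_tendstoD) simp
  then obtain k where "(A * real k + B) / 2 ^ k < 1" by (auto simp: eventually_sequentially)
  then show ?thesis by (auto simp: field_simps)
qed

text \<open>The two boundary paths of a square join opposite corners and are both logarithmically close
  to a geodesic, although they are linearly far from each other away from the corners.\<close>
lemma Gromov_hyperbolic_no_quasi_flat:
  assumes hyp: "Gromov_hyperbolic X d" and D: "0 \<le> D" and C: "0 \<le> C"
    and flat: "\<And>n::nat. \<exists>g. (\<forall>i\<le>n. \<forall>j\<le>n. g i j \<in> X) \<and>
      (\<forall>i<n. \<forall>j\<le>n. d (g i j) (g (Suc i) j) \<le> D) \<and> (\<forall>i\<le>n. \<forall>j<n. d (g i j) (g i (Suc j)) \<le> D) \<and>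
      (\<forall>i\<le>n. \<forall>j\<le>n. \<forall>i'\<le>n. \<forall>j'\<le>n. \<bar>real i - real i'\<bar> \<le> d (g i j) (g i' j') + C \<and>
         \<bar>real j - real j'\<bar> \<le> d (g i j) (g i' j') + C)"
  shows False
proof -
  interpret Metric_space X d using hyp unfolding Gromov_hyperbolic_def proper_geodesic_space_def by blast
  have met: "Metric_space X d" by unfold_locales
  have geod: "\<And>x y. x \<in> X \<Longrightarrow> y \<in> X \<Longrightarrow> \<exists>A. geodesic_segment X d x y A"
    using hyp unfolding Gromov_hyperbolic_def proper_geodesic_space_def by blast
  obtain r where r: "r > 0" and thin: "\<And>x y z A B C. \<lbrakk>x \<in> X; y \<in> X; z \<in> X; geodesic_segment X d y z A;
        geodesic_segment X d z x B; geodesic_segment X d x y C\<rbrakk> \<Longrightarrow> in_nbhd d r A (B \<union> C)"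
    using hyp unfolding Gromov_hyperbolic_def by metis
  \<comment> \<open>With \<open>E\<close> from below, \<open>A1 * real k + B1\<close> is
    \<open>2 * E + 2 * D * (2 * E + C) + C\<close> plus 1, sorted by powers of \<open>k\<close>. The
    square gets side \<open>2 ^ k\<close>, which outgrows all errors.\<close>
  define A1 where "A1 = 2 * r + 4 * D * r"
  define B1 where "B1 = 2 * (r + D) + 4 * D * (r + D) + 2 * D * C + C + 1"
  obtain k :: nat where k: "A1 * real k + B1 < 2 ^ k" using ex_pow2_gt_linear by blast
  define n :: nat where "n = 2 ^ k"
  \<comment> \<open>A boundary path between opposite corners has \<open>2 * n = 2 ^ Suc k\<close>
    steps, hence \<open>Suc k\<close>.\<close>
  define E where "E = real (Suc k) * r + D"
  have E0: "0 \<le> E" using r D by (auto simp: E_def)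
  have nE: "2 * E + 2 * D * (2 * E + C) + C < real n"
    using k by (simp add: n_def E_def A1_def B1_def algebra_simps)
  have "0 \<le> D * (2 * E + C)" using D C E0 by simp
  then have nE': "2 * E + C < real n" using nE by simp
  have n0: "n > 0" by (simp add: n_def)
  obtain g where g: "(\<forall>i\<le>n. \<forall>j\<le>n. g i j \<in> X) \<and>
      (\<forall>i<n. \<forall>j\<le>n. d (g i j) (g (Suc i) j) \<le> D) \<and> (\<forall>i\<le>n. \<forall>j<n. d (g i j) (g i (Suc j)) \<le> D) \<and>
      (\<forall>i\<le>n. \<forall>j\<le>n. \<forall>i'\<le>n. \<forall>j'\<le>n. \<bar>real i - real i'\<bar> \<le> d (g i j) (g i' j') + C \<and>
         \<bar>real j - real j'\<bar> \<le> d (g i j) (g i' j') + C)"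
    using flat[of n] by (elim exE)
  have gX: "g i j \<in> X" if "i \<le> n" "j \<le> n" for i j using g that by simp
  have gi: "d (g i j) (g (Suc i) j) \<le> D" if "i < n" "j \<le> n" for i j using g that by simp
  have gj: "d (g i j) (g i (Suc j)) \<le> D" if "i \<le> n" "j < n" for i j using g that by simp
  have lowi: "\<bar>real i - real i'\<bar> \<le> d (g i j) (g i' j') + C"
    and lowj: "\<bar>real j - real j'\<bar> \<le> d (g i j) (g i' j') + C"
    if "i \<le> n" "j \<le> n" "i' \<le> n" "j' \<le> n" for i j i' j' using g that by simp_all
  \<comment> \<open>\<open>x\<close> follows the sides \<open>j = 0\<close> and then
    \<open>i = n\<close>, \<open>y\<close> the sides \<open>i = 0\<close> and then
    \<open>j = n\<close>; both run from \<open>g 0 0\<close> to \<open>g n n\<close>.\<close>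
  define x where "x i = (if i \<le> n then g i 0 else g n (i - n))" for i
  define y where "y i = (if i \<le> n then g 0 i else g (i - n) n)" for i
  have xX: "x i \<in> X" if "i \<le> 2 * n" for i using that gX by (auto simp: x_def)
  have yX: "y i \<in> X" if "i \<le> 2 * n" for i using that gX by (auto simp: y_def)
  have xs: "d (x i) (x (Suc i)) \<le> D" if "i < 2 * n" for i
    using that gi[of i 0] gj[of n "i - n"]
    by (cases i n rule: linorder_cases) (auto simp: x_def Suc_diff_le)
  have ys: "d (y i) (y (Suc i)) \<le> D" if "i < 2 * n" for i
    using that gj[of 0 i] gi[of "i - n" n]
    by (cases i n rule: linorder_cases) (auto simp: y_def Suc_diff_le)
  have ends: "x 0 = g 0 0" "y 0 = g 0 0" "x (2 * n) = g n n" "y (2 * n) = g n n"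
    using n0 by (auto simp: x_def y_def)
  have le: "2 * n \<le> 2 ^ Suc k" by (simp add: n_def)
  have XY: "g 0 0 \<in> X" "g n n \<in> X" using gX by auto
  obtain A where A: "geodesic_segment X d (g 0 0) (g n n) A" using geod XY by blast
  obtain \<sigma> where s: "\<sigma> 0 = g 0 0" "\<sigma> (d (g 0 0) (g n n)) = g n n" "A = \<sigma> ` {0..d (g 0 0) (g n n)}" "A \<subseteq> X"
    and iso: "\<And>s t. s \<in> {0..d (g 0 0) (g n n)} \<Longrightarrow> t \<in> {0..d (g 0 0) (g n n)} \<Longrightarrow> d (\<sigma> s) (\<sigma> t) = \<bar>s - t\<bar>"
    using A unfolding geodesic_segment_def by blast
  define l where "l = d (g 0 0) (g n n)"
  have l: "0 \<le> l" "real n \<le> l + C" using lowi[of 0 0 n n] by (auto simp: l_def)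
  \<comment> \<open>The midpoint is far from both corners, yet both boundary paths must pass close
    to it.\<close>
  define p where "p = \<sigma> (l / 2)"
  have pA: "p \<in> A" unfolding s(3) p_def using l by (auto simp: l_def)
  have pX: "p \<in> X" using pA s by auto
  have p0: "d (g 0 0) p = l / 2" using iso[of 0 "l/2"] s(1) l by (auto simp: p_def l_def)
  have p1: "d (g n n) p = l / 2" using iso[of "d (g 0 0) (g n n)" "l/2"] s(2) l by (auto simp: p_def l_def)
  have "\<exists>i\<le>2*n. d p (x i) \<le> E"
    unfolding E_def by (rule geodesic_near_chain[OF met _ D geod thin le]) (use r xX xs A pA ends in auto)
  then obtain i where i: "i \<le> 2 * n" "d p (x i) \<le> E" by blast
  have "\<exists>i\<le>2*n. d p (y i) \<le> E"
    unfolding E_def by (rule geodesic_near_chain[OF met _ D geod thin le]) (use r yX ys A pA ends in auto)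
  then obtain j where j: "j \<le> 2 * n" "d p (y j) \<le> E" by blast
  have ijn: "i - n \<le> n" "j - n \<le> n" using i j by auto
  have "d (x i) (y j) \<le> d p (x i) + d p (y j)" using triangle[of "x i" p "y j"] commute[of p "x i"] xX yX i j pX by auto
  then have ij: "d (x i) (y j) \<le> 2 * E" using i j by simp
  \<comment> \<open>Opposite sides are more than \<open>2 * E\<close> apart by \<open>nE'\<close>,
    so \<open>x i\<close> and \<open>y j\<close> lie on sides sharing the corner
    \<open>g 0 0\<close> or \<open>g n n\<close>. Comparing coordinates shows that
    \<open>x i\<close> is few steps away from that corner, so \<open>p\<close> is near it too,
    against \<open>l \<ge> n - C\<close>.\<close>
  have close: "l / 2 \<le> E + D * (2 * E + C)"
  proof (cases "i \<le> n")
    case True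
    have "j \<le> n"
    proof (rule ccontr)
      assume "\<not> j \<le> n"
      then show False using lowj[of i 0 "j - n" n] ij True ijn nE' by (simp add: x_def y_def)
    qed
    then have "real i \<le> 2 * E + C" using lowi[of i 0 0 j] ij True by (simp add: x_def y_def)
    then have "real i * D \<le> D * (2 * E + C)" using D by (simp add: mult.commute mult_left_mono)
    moreover have "d (g 0 0) p \<le> d (g 0 0) (x i) + d p (x i)"
      using triangle[of "g 0 0" "x i" p] commute[of p "x i"] XY xX i pX by auto
    moreover have "d (x 0) (x (0 + i)) \<le> real i * D"
      by (rule chain_dist_le[OF met, where N = "2 * n"]) (use xX xs i in auto)
    ultimately show ?thesis using p0 i(2) ends(1) by simp
  next
    case False
    have "\<not> j \<le> n"
    proof
      assume "j \<le> n"
      then show False using lowi[of n "i - n" 0 j] ij False ijn nE' by (simp add: x_def y_def)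
    qed
    then have "real n - real (i - n) \<le> 2 * E + C"
      using lowj[of n "i - n" "j - n" n] ij False \<open>\<not> j \<le> n\<close> ijn by (simp add: x_def y_def)
    then have "real (2 * n - i) \<le> 2 * E + C" using False i(1) by (simp add: of_nat_diff)
    then have "real (2 * n - i) * D \<le> D * (2 * E + C)" using D by (simp add: mult.commute mult_left_mono)
    moreover have "d (g n n) p \<le> d (x i) (g n n) + d p (x i)"
      using triangle[of "g n n" "x i" p] commute[of p "x i"] commute[of "g n n" "x i"] XY xX i pX by auto
    moreover have "d (x i) (x (i + (2 * n - i))) \<le> real (2 * n - i) * D"
      by (rule chain_dist_le[OF met, where N = "2 * n"]) (use xX xs i in auto)
    ultimately show ?thesis using p1 i ends(3) by simp
  qed
  then show False using l nE by (simp add: algebra_simps)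
qed


section \<open>Causal order of Minkowski space\<close>

definition causal_le :: "'n::finite mink \<Rightarrow> 'n mink \<Rightarrow> bool" where
  "causal_le x y \<longleftrightarrow> norm (snd (y - x)) \<le> fst (y - x)"

lemma inner_self_le_iff_norm_le: "0 \<le> c \<Longrightarrow> v \<bullet> v \<le> c * c \<longleftrightarrow> norm v \<le> c"
  for v :: "'a::real_inner"
  using power2_norm_eq_inner[of v] power2_le_iff_abs_le[of c "norm v"] by (simp add: power2_eq_square)

definition chron :: "'n::finite mink \<Rightarrow> 'n mink \<Rightarrow> bool" where
  "chron x y \<longleftrightarrow> norm (snd (y - x)) < fst (y - x)"

definition chron_future :: "'n::finite mink set \<Rightarrow> 'n mink set" where
  "chron_future A = {y. \<exists>x\<in>A. chron x y}"

definition chron_past :: "'n::finite mink set \<Rightarrow> 'n mink set" where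
  "chron_past A = {x. \<exists>y\<in>A. chron x y}"

lemma chron_imp_causal_le: "chron x y \<Longrightarrow> causal_le x y"
  by (simp add: chron_def causal_le_def)

lemma causal_le_refl [simp]: "causal_le x x"
  by (simp add: causal_le_def)

lemma norm_snd_diff_triangle: "norm (snd (z - x)) \<le> norm (snd (y - x)) + norm (snd (z - y))"
  for x y z :: "'n::finite mink"
  using norm_triangle_ineq[of "snd y - snd x" "snd z - snd y"] by simp

lemma causal_le_trans: "causal_le x y \<Longrightarrow> causal_le y z \<Longrightarrow> causal_le x z"
  using norm_snd_diff_triangle[of z x y] by (simp add: causal_le_def)

lemma chron_causal_le_trans: "chron x y \<Longrightarrow> causal_le y z \<Longrightarrow> chron x z"
  using norm_snd_diff_triangle[of z x y] by (simp add: causal_le_def chron_def)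

lemma causal_le_chron_trans: "causal_le x y \<Longrightarrow> chron y z \<Longrightarrow> chron x z"
  using norm_snd_diff_triangle[of z x y] by (simp add: causal_le_def chron_def)

lemma causal_le_fst_less:
  assumes "causal_le x y" "x \<noteq> y"
  shows "fst x < fst y"
proof -
  have le: "norm (snd (y - x)) \<le> fst y - fst x" using assms(1) by (simp add: causal_le_def)
  have "fst x \<noteq> fst y"
  proof
    assume "fst x = fst y"
    with le assms(2) show False by (auto simp: prod_eq_iff)
  qed
  then show ?thesis using le norm_ge_zero[of "snd (y - x)"] by linarith
qed

lemma causal_le_antisym: "causal_le x y \<Longrightarrow> causal_le y x \<Longrightarrow> x = y"
  using causal_le_fst_less[of x y] causal_le_fst_less[of y x] by force

lemma chron_time_shift: "s > 0 \<Longrightarrow> chron x (x + (s, 0))"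
  by (simp add: chron_def)

lemma open_chron_above: "open {y. chron x y}"
  unfolding chron_def by (intro open_Collect_less continuous_intros)

lemma open_chron_below: "open {x. chron x y}"
  unfolding chron_def by (intro open_Collect_less continuous_intros)

lemma closed_causal_le_above: "closed {y. causal_le x y}"
  unfolding causal_le_def by (intro closed_Collect_le continuous_intros)

lemma closed_causal_le_below: "closed {x. causal_le x y}"
  unfolding causal_le_def by (intro closed_Collect_le continuous_intros)

lemma open_chron_future: "open (chron_future A)"
proof -
  have "chron_future A = (\<Union>x\<in>A. {y. chron x y})" by (auto simp: chron_future_def)
  then show ?thesis by (simp only: open_UN[OF ballI, OF open_chron_above])
qed

lemma open_chron_past: "open (chron_past A)"
proof -
  have "chron_past A = (\<Union>y\<in>A. {x. chron x y})" by (auto simp: chron_past_def)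
  then show ?thesis by (simp only: open_UN[OF ballI, OF open_chron_below])
qed

lemma chron_future_up: "x \<in> chron_future A \<Longrightarrow> causal_le x y \<Longrightarrow> y \<in> chron_future A"
  unfolding chron_future_def using chron_causal_le_trans by blast

lemma chron_past_down: "y \<in> chron_past A \<Longrightarrow> causal_le x y \<Longrightarrow> x \<in> chron_past A"
  unfolding chron_past_def using causal_le_chron_trans by blast

lemma chron_past_Un: "chron_past (A \<union> B) = chron_past A \<union> chron_past B"
  by (auto simp: chron_past_def)

lemma open_time_shift:
  fixes A :: "'n::finite mink set"
  assumes "open A" "x \<in> A"
  obtains s :: real where "s > 0" "x + (s, 0) \<in> A" "x - (s, 0) \<in> A"
proof -
  obtain e where e: "e > 0" "ball x e \<subseteq> A" using assms by (meson openE)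
  have "x + (e/2, 0) \<in> A" "x - (e/2, 0) \<in> A"
    by (rule subsetD[OF e(2)], use e(1) in \<open>simp add: dist_norm norm_Pair\<close>)+
  then show thesis using that[of "e/2"] e(1) by simp
qed

lemma open_subset_chron_future: "open A \<Longrightarrow> A \<subseteq> chron_future A"
proof
  fix x assume "open A" "x \<in> A"
  then obtain s :: real where "s > 0" "x - (s, 0) \<in> A" by (meson open_time_shift)
  then show "x \<in> chron_future A"
    using chron_time_shift[of s "x - (s, 0)"] by (auto simp: chron_future_def)
qed

lemma open_subset_chron_past: "open A \<Longrightarrow> A \<subseteq> chron_past A"
proof
  fix x assume "open A" "x \<in> A"
  then obtain s :: real where "s > 0" "x + (s, 0) \<in> A" by (meson open_time_shift)
  then show "x \<in> chron_past A"
    using chron_time_shift[of s x] by (auto simp: chron_past_def)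
qed

text \<open>The chronological relation is open in each argument, so points of the closure can be
  replaced by nearby points of \<open>A\<close>.\<close>

lemma closure_chron_between:
  assumes "x \<in> closure A" "y \<in> closure A" "chron x z" "chron z y"
  shows "\<exists>x'\<in>A. \<exists>y'\<in>A. chron x' z \<and> chron z y'"
proof -
  have "{x. chron x z} \<inter> A \<noteq> {}"
    using assms open_chron_below[of z] by (metis IntI closure_iff_nhds_not_empty empty_iff mem_Collect_eq order_refl inf_commute)
  moreover have "{y. chron z y} \<inter> A \<noteq> {}"
    using assms open_chron_above[of z] by (metis IntI closure_iff_nhds_not_empty empty_iff mem_Collect_eq order_refl inf_commute)
  ultimately show ?thesis by blast
qed


section \<open>Smoothness of affine maps\<close>

lemma smooth_on_affine:
  fixes f :: "'a::euclidean_space \<Rightarrow> 'b::euclidean_space"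
  assumes "open S" "bounded_linear A" "\<And>x. x \<in> S \<Longrightarrow> f x = A x + c"
  shows "smooth_on S f" "\<And>x. x \<in> S \<Longrightarrow> frechet_derivative f (at x) = A"
proof -
  have der: "(f has_derivative A) (at x)"
    if "open S" "bounded_linear A" "\<And>x. x \<in> S \<Longrightarrow> f x = A x + c" "x \<in> S"
    for f :: "'a \<Rightarrow> 'b" and A c x
  proof -
    have "((\<lambda>x. A x + c) has_derivative A) (at x)"
      using bounded_linear_imp_has_derivative[OF that(2)] by (auto intro!: derivative_eq_intros)
    then show ?thesis
      using has_derivative_transform_within_open[of _ A x UNIV S f] that by simp
  qed
  have "Ck_on k S f" if "open S" "bounded_linear A" "\<And>x. x \<in> S \<Longrightarrow> f x = A x + c"
    for k and f :: "'a \<Rightarrow> 'b" and A c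
    using that
  proof (induction k arbitrary: f A c)
    case 0
    have "continuous_on S (\<lambda>x. A x + c)"
      using 0 by (intro continuous_intros linear_continuous_on) auto
    then show ?case using 0 by (simp cong: continuous_on_cong)
  next
    case (Suc k)
    have d: "frechet_derivative f (at x) = A" if "x \<in> S" for x
      using der[OF Suc.prems that] frechet_derivative_at by metis
    \<comment> \<open>Evaluated at \<open>v\<close>, the derivative is the constant
      \<open>A v\<close>, an affine map with linear part 0, to which the induction hypothesis
      applies.\<close>
    have "Ck_on k S (\<lambda>x. frechet_derivative f (at x) v)" for v
      by (rule Suc.IH[of "\<lambda>_. 0" _ "A v"]) (use Suc.prems d in \<open>auto simp: bounded_linear_zero\<close>)
    then show ?case using der[OF Suc.prems] by (auto simp: differentiable_def)
  qed
  then show "smooth_on S f" unfolding smooth_on_def using assms by blast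
  show "frechet_derivative f (at x) = A" if "x \<in> S" for x
    using der[OF assms that] frechet_derivative_at by metis
qed

lemma smooth_on_imp_differentiable: "smooth_on S f \<Longrightarrow> x \<in> S \<Longrightarrow> f differentiable (at x)"
  unfolding smooth_on_def using Ck_on.simps(2) by blast


section \<open>Open subsets of Minkowski space as spacetimes\<close>

lemma mink_spacetime_simps [simp]:
  "points (mink_spacetime W) = W" "topo (mink_spacetime W) = top_of_set W"
  "atlas (mink_spacetime W) = {(W, id)}"
  by (simp_all add: mink_spacetime_def)

lemma future_cone_mink [simp]:
  "v \<in> future_cone (mink_spacetime W) c x \<longleftrightarrow> v \<noteq> 0 \<and> mink_form v v \<le> 0 \<and> 0 < fst v"
  by (auto simp: future_cone_def mink_spacetime_def mink_form_def)

lemma past_cone_mink [simp]: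
  "v \<in> past_cone (mink_spacetime W) c x \<longleftrightarrow> v \<noteq> 0 \<and> mink_form v v \<le> 0 \<and> fst v < 0"
  by (auto simp: past_cone_def mink_spacetime_def mink_form_def)

lemma in_charts_id:
  assumes "x \<in> W"
  shows "in_charts (W, id) (W', id) id x = x"
  using assms f_inv_into_f[of x id W] by (simp add: in_charts_def)

lemma in_charts_id_smooth:
  fixes W W' :: "'n::finite mink set"
  assumes "open W"
  shows "smooth_on W (in_charts (W, id) (W', id) id)"
    "\<And>x. x \<in> W \<Longrightarrow> frechet_derivative (in_charts (W, id) (W', id) id) (at x) = (\<lambda>x. x)"
  using smooth_on_affine[OF assms bounded_linear_ident, of "in_charts (W, id) (W', id) id" 0]
  by (auto simp: in_charts_id)

lemma second_countable_euclidean: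
  "second_countable (euclidean :: 'a::second_countable_topology topology)"
proof -
  obtain B :: "'a set set" where "countable B" "\<And>C. C \<in> B \<Longrightarrow> open C"
    "\<And>S. open S \<Longrightarrow> \<exists>U. U \<subseteq> B \<and> S = \<Union>U"
    using univ_second_countable by blast
  then show ?thesis
    unfolding second_countable_def by (intro exI[of _ B]) (fastforce simp: subset_iff)
qed

lemma conformal_spacetime_mink:
  fixes W :: "'n::finite mink set"
  assumes "open W"
  shows "conformal_spacetime (mink_spacetime W)"
proof -
  have "smooth_manifold (mink_spacetime W)"
    unfolding smooth_manifold_def mink_spacetime_def
    using assms in_charts_id_smooth(1)[OF assms]
    by (auto simp: Hausdorff_space_subtopology Hausdorff_space_euclidean subtopology_subtopology
        intro!: second_countable_subtopology second_countable_euclidean)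
  moreover have "lorentz_form (mink_form :: 'n mink \<Rightarrow> _)"
    unfolding lorentz_form_def by (intro exI[of _ id]) (auto simp: linear_id)
  moreover have "smooth_on W (\<lambda>x. mink_form v w)" for v w :: "'n mink"
    by (rule smooth_on_affine[OF assms bounded_linear_zero]) auto
  ultimately show ?thesis
    unfolding conformal_spacetime_def
    using in_charts_id_smooth(2)[OF assms, of _ W]
    by (auto simp: mink_spacetime_def mink_form_def Let_def)
qed

lemma conformal_map_mink_inclusion:
  fixes W W' :: "'n::finite mink set"
  assumes "open W" "W \<subseteq> W'"
  shows "conformal_map (mink_spacetime W) (mink_spacetime W') id"
proof -
  have "(1, 0) \<in> future_cone (mink_spacetime W') c y" for c and y :: "'n mink"
    by (simp add: mink_form_def prod_eq_iff)
  moreover have "\<exists>V. openin (top_of_set W) V \<and> p \<in> V \<and> V \<subseteq> W \<and> V \<subseteq> W' \<and>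
      smooth_on V (in_charts (W, id) (W', id) id)" if "p \<in> W" for p
    using that assms in_charts_id_smooth(1) by (intro exI[of _ W]) auto
  ultimately show ?thesis
    unfolding conformal_map_def
    using assms in_charts_id_smooth(2)[OF assms(1), of _ W']
    by (auto simp: mink_spacetime_def Let_def intro!: exI[of _ 1])
qed


section \<open>Causal curves in Minkowski space\<close>

text \<open>The sign treats future and past directed curves together. Equality is excluded because
  causal velocities are nonzero; this later makes crossings unique.\<close>

definition causal_order :: "real \<Rightarrow> 'n::finite mink \<Rightarrow> 'n mink \<Rightarrow> bool" where
  "causal_order \<sigma> x y \<longleftrightarrow> norm (snd (y - x)) \<le> \<sigma> * fst (y - x) \<and> x \<noteq> y"

lemma causal_order_1 [simp]: "causal_order 1 x y \<longleftrightarrow> causal_le x y \<and> x \<noteq> y"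
  by (simp add: causal_order_def causal_le_def)

lemma causal_order_minus_1 [simp]: "causal_order (-1) x y \<longleftrightarrow> causal_le y x \<and> x \<noteq> y"
  by (simp add: causal_order_def causal_le_def norm_minus_commute)

lemma causal_order_trans:
  assumes "\<sigma> \<in> {1, -1}" "causal_order \<sigma> x y" "causal_order \<sigma> y z"
  shows "causal_order \<sigma> x z"
  using assms causal_le_trans[of x y z] causal_le_antisym[of x y] causal_le_trans[of z y x]
    causal_le_antisym[of y z] by auto

definition cone_of_sign :: "real \<Rightarrow> ('a, 'n::finite) spacetime \<Rightarrow> ('a, 'n) chart \<Rightarrow> 'n mink \<Rightarrow> 'n mink set" where
  "cone_of_sign \<sigma> = (if \<sigma> = 1 then future_cone else past_cone)"

lemma cone_of_signD:
  assumes "\<sigma> \<in> {1, -1}" "v \<in> cone_of_sign \<sigma> (mink_spacetime W) c x"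
  shows "norm (snd v) \<le> \<sigma> * fst v" "0 < \<sigma> * fst v"
proof -
  have v: "v \<noteq> 0" "snd v \<bullet> snd v \<le> fst v * fst v" "0 < \<sigma> * fst v"
    using assms by (auto simp: cone_of_sign_def mink_form_def)
  show "0 < \<sigma> * fst v" by fact
  have "snd v \<bullet> snd v \<le> (\<sigma> * fst v) * (\<sigma> * fst v)"
    using v(2) assms(1) by auto
  then show "norm (snd v) \<le> \<sigma> * fst v"
    by (simp only: inner_self_le_iff_norm_le[OF less_imp_le[OF v(3)]])
qed

text \<open>Trades the local extensions \<open>\<kappa>\<close> in \<open>smooth_arc\<close> for
  derivatives within \<open>{a..b}\<close>, one-sided at the end points.\<close>

lemma smooth_arc_derivative:
  assumes "smooth_arc (mink_spacetime W) C \<gamma> a b" "s \<in> {a..b}"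
  shows "\<gamma> s \<in> W"
    "\<exists>v\<in>C (W, id) (\<gamma> s). (\<gamma> has_vector_derivative v) (at s within {a..b})"
proof -
  note arc = assms(1)[unfolded smooth_arc_def, THEN conjunct2, THEN bspec, OF assms(2)]
  show W: "\<gamma> s \<in> W" using conjunct1[OF arc] by (simp add: mink_spacetime_def)
  have "\<exists>V \<kappa>. open V \<and> s \<in> V \<and> \<gamma> ` (V \<inter> {a..b}) \<subseteq> W \<and> smooth_on V \<kappa> \<and>
      (\<forall>u\<in>V \<inter> {a..b}. \<kappa> u = \<gamma> u) \<and> vector_derivative \<kappa> (at s) \<in> C (W, id) (\<gamma> s)"
    using bspec[OF conjunct2[OF arc], of "(W, id)"] W by (simp add: mink_spacetime_def)
  then obtain V \<kappa> where V: "open V" "s \<in> V" "smooth_on V \<kappa>" "\<forall>u\<in>V \<inter> {a..b}. \<kappa> u = \<gamma> u"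
    "vector_derivative \<kappa> (at s) \<in> C (W, id) (\<gamma> s)" by (elim exE conjE)
  have "(\<kappa> has_vector_derivative vector_derivative \<kappa> (at s)) (at s within {a..b})"
    using smooth_on_imp_differentiable[OF V(3,2)]
    by (rule has_vector_derivative_at_within[OF iffD1[OF vector_derivative_works]])
  moreover have "eventually (\<lambda>u. \<kappa> u = \<gamma> u) (at s within {a..b})"
    unfolding eventually_at_topological using V(1,2,4) by blast
  moreover have "\<kappa> s = \<gamma> s" using V(2,4) assms(2) by blast
  ultimately have "(\<gamma> has_vector_derivative vector_derivative \<kappa> (at s)) (at s within {a..b})"
    unfolding has_vector_derivative_def
    using assms(2) by (rule has_derivative_transform_eventually)
  then show "\<exists>v\<in>C (W, id) (\<gamma> s). (\<gamma> has_vector_derivative v) (at s within {a..b})"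
    using V(5) by (rule bexI)
qed

text \<open>Apply the scalar mean value theorem to \<open>\<sigma> * fst - e \<bullet> snd\<close>
  along the curve. Taking for \<open>e\<close> the direction of the spatial displacement gives the
  cone inequality, and \<open>e = 0\<close> gives strictness.\<close>

lemma smooth_arc_causal_order:
  fixes \<gamma> :: "real \<Rightarrow> 'n::finite mink"
  assumes \<sigma>: "\<sigma> \<in> {1, -1}"
    and arc: "smooth_arc (mink_spacetime W) (cone_of_sign \<sigma> (mink_spacetime W)) \<gamma> a b"
    and st: "a \<le> s" "s < t" "t \<le> b"
  shows "causal_order \<sigma> (\<gamma> s) (\<gamma> t)"
proof -
  have "\<forall>u\<in>{a..b}. \<exists>v. norm (snd v) \<le> \<sigma> * fst v \<and> 0 < \<sigma> * fst v \<and>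
      (\<gamma> has_vector_derivative v) (at u within {a..b})"
    using smooth_arc_derivative[OF arc] cone_of_signD[OF \<sigma>] by meson
  then obtain v where v: "\<And>u. u \<in> {a..b} \<Longrightarrow> norm (snd (v u)) \<le> \<sigma> * fst (v u) \<and> 0 < \<sigma> * fst (v u) \<and>
      (\<gamma> has_vector_derivative v u) (at u within {a..b})" by metis
  have sub: "{s..t} \<subseteq> {a..b}" using st by auto
  have mvt: "\<exists>u\<in>{s<..<t}. \<sigma> * fst (\<gamma> t - \<gamma> s) - e \<bullet> snd (\<gamma> t - \<gamma> s) =
      (t - s) * (\<sigma> * fst (v u) - e \<bullet> snd (v u))" for e
  proof -
    have "\<exists>u\<in>{s<..<t}. (\<lambda>u. \<sigma> * fst (\<gamma> u) - e \<bullet> snd (\<gamma> u)) t - (\<lambda>u. \<sigma> * fst (\<gamma> u) - e \<bullet> snd (\<gamma> u)) s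
        = (\<lambda>h. \<sigma> * fst (h *\<^sub>R v u) - e \<bullet> snd (h *\<^sub>R v u)) (t - s)"
    proof (rule mvt_simple[OF st(2)])
      fix u assume "s \<le> u" "u \<le> t"
      then have "u \<in> {a..b}" using sub by auto
      then have "(\<gamma> has_derivative (\<lambda>h. h *\<^sub>R v u)) (at u within {s..t})"
        using v sub has_derivative_subset unfolding has_vector_derivative_def by blast
      then show "((\<lambda>u. \<sigma> * fst (\<gamma> u) - e \<bullet> snd (\<gamma> u)) has_derivative
          (\<lambda>h. \<sigma> * fst (h *\<^sub>R v u) - e \<bullet> snd (h *\<^sub>R v u))) (at u within {s..t})"
        by (auto intro!: derivative_eq_intros)
    qed
    then show ?thesis by (simp add: algebra_simps inner_diff_right)
  qed
  have "norm (snd (\<gamma> t - \<gamma> s)) \<le> \<sigma> * fst (\<gamma> t - \<gamma> s)"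
  proof -
    define e where "e = sgn (snd (\<gamma> t - \<gamma> s))"
    obtain u where u: "u \<in> {s<..<t}" "\<sigma> * fst (\<gamma> t - \<gamma> s) - e \<bullet> snd (\<gamma> t - \<gamma> s) =
      (t - s) * (\<sigma> * fst (v u) - e \<bullet> snd (v u))" using mvt by blast
    have "norm e \<le> 1" by (simp add: e_def norm_sgn)
    then have "e \<bullet> snd (v u) \<le> norm (snd (v u))"
      using Cauchy_Schwarz_ineq2[of e "snd (v u)"] mult_right_mono[of "norm e" 1 "norm (snd (v u))"] by auto
    then have "0 \<le> \<sigma> * fst (v u) - e \<bullet> snd (v u)" using v[of u] u(1) st by auto
    then have "0 \<le> \<sigma> * fst (\<gamma> t - \<gamma> s) - e \<bullet> snd (\<gamma> t - \<gamma> s)" using u(2) st(2) by simp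
    moreover have "e \<bullet> snd (\<gamma> t - \<gamma> s) = norm (snd (\<gamma> t - \<gamma> s))"
      unfolding e_def sgn_div_norm inner_scaleR_left dot_square_norm
      by (cases "snd (\<gamma> t - \<gamma> s) = 0") (simp_all add: power2_eq_square)
    ultimately show ?thesis by simp
  qed
  moreover have "\<gamma> s \<noteq> \<gamma> t"
  proof -
    obtain u where u: "u \<in> {s<..<t}" "\<sigma> * fst (\<gamma> t - \<gamma> s) = (t - s) * (\<sigma> * fst (v u))" using mvt[of 0] by auto
    have "0 < \<sigma> * fst (v u)" using v[of u] u(1) st by auto
    then have "0 < \<sigma> * fst (\<gamma> t - \<gamma> s)"
      unfolding u(2) using st(2) by (simp add: mult_pos_pos del: zero_less_mult_iff)
    then show ?thesis by auto
  qed
  ultimately show ?thesis by (simp add: causal_order_def)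
qed

lemma piecewise_smooth_arc_causal_order:
  fixes \<gamma> :: "real \<Rightarrow> 'n::finite mink"
  assumes \<sigma>: "\<sigma> \<in> {1, -1}"
    and "piecewise_smooth_arc (mink_spacetime W) (cone_of_sign \<sigma> (mink_spacetime W)) \<gamma> a b"
  shows "a < b \<and> \<gamma> ` {a..b} \<subseteq> W \<and> continuous_on {a..b} \<gamma> \<and>
    (\<forall>s t. a \<le> s \<longrightarrow> s < t \<longrightarrow> t \<le> b \<longrightarrow> causal_order \<sigma> (\<gamma> s) (\<gamma> t))"
  using assms(2)
proof induction
  case (smooth a b)
  have "a < b" using smooth by (simp add: smooth_arc_def)
  moreover have "continuous_on {a..b} \<gamma>"
    using smooth_arc_derivative(2)[OF smooth]
    by (meson has_vector_derivative_continuous continuous_on_eq_continuous_within)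
  ultimately show ?case
    using smooth_arc_derivative(1)[OF smooth] smooth_arc_causal_order[OF \<sigma> smooth] by blast
next
  case (join a m b)
  have U: "{a..b} = {a..m} \<union> {m..b}" using join.IH by auto
  have "continuous_on {a..b} \<gamma>" unfolding U using join.IH by (intro continuous_on_closed_Un) auto
  moreover have "causal_order \<sigma> (\<gamma> s) (\<gamma> t)" if "a \<le> s" "s < t" "t \<le> b" for s t
  proof -
    consider "t \<le> m" | "m \<le> s" | "s < m" "m < t" by linarith
    then show ?thesis
    proof cases
      case 3
      then have "causal_order \<sigma> (\<gamma> s) (\<gamma> m)" "causal_order \<sigma> (\<gamma> m) (\<gamma> t)" using join.IH that by auto
      then show ?thesis using causal_order_trans[OF \<sigma>] by blast
    qed (use join.IH that in blast)+
  qed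
  moreover have "\<gamma> ` {a..b} \<subseteq> W" unfolding U image_Un using join.IH by blast
  ultimately show ?case using join.IH by auto
qed

lemma smooth_arc_segment:
  assumes "a < b" "\<And>u. u \<in> {a..b} \<Longrightarrow> \<gamma> u = x + (u - c) *\<^sub>R v" "causal_le 0 v" "v \<noteq> 0"
  shows "smooth_arc (mink_spacetime UNIV) (future_cone (mink_spacetime UNIV)) \<gamma> a b"
proof -
  define \<kappa> where "\<kappa> u = x + (u - c) *\<^sub>R v" for u
  have bl: "bounded_linear (\<lambda>u. u *\<^sub>R v)" by (rule bounded_linear_scaleR_left)
  have sm: "smooth_on UNIV \<kappa>"
    by (rule smooth_on_affine[OF _ bl, where c = "x - c *\<^sub>R v"]) (auto simp: \<kappa>_def algebra_simps)
  have "vector_derivative \<kappa> (at u) = v" for u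
    unfolding \<kappa>_def by (rule vector_derivative_at) (auto intro!: derivative_eq_intros)
  moreover have "0 < fst v" "mink_form v v \<le> 0"
  proof -
    have v: "norm (snd v) \<le> fst v" "0 < fst v"
      using assms(3,4) causal_le_fst_less[of 0 v] by (auto simp: causal_le_def)
    show "0 < fst v" "mink_form v v \<le> 0"
      using v(1) inner_self_le_iff_norm_le[OF less_imp_le[OF v(2)], of "snd v"] v(2)
      by (simp_all add: mink_form_def)
  qed
  ultimately show ?thesis
    unfolding smooth_arc_def using assms(1,2,4) sm
    by (auto simp: \<kappa>_def intro!: exI[of _ UNIV] exI[of _ \<kappa>])
qed

lemma causally_convexD:
  assumes cc: "causally_convex \<Omega>" and "x \<in> \<Omega>" "y \<in> \<Omega>" "causal_le x z" "causal_le z y"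
  shows "z \<in> \<Omega>"
proof (cases "z = x \<or> z = y")
  case False
  \<comment> \<open>The broken line from \<open>x\<close> through \<open>z\<close> to
    \<open>y\<close>. As \<open>z\<close> is neither \<open>x\<close> nor \<open>y\<close>, both
    velocities are nonzero, as the cones demand.\<close>
  define \<gamma> where "\<gamma> u = (if u \<le> 1 then x + u *\<^sub>R (z - x) else z + (u - 1) *\<^sub>R (y - z))" for u :: real
  let ?M = "mink_spacetime UNIV"
  have "smooth_arc ?M (future_cone ?M) \<gamma> 0 1"
    by (rule smooth_arc_segment[of _ _ _ x 0 "z - x"]) (use False assms in \<open>auto simp: \<gamma>_def causal_le_def\<close>)
  moreover have "smooth_arc ?M (future_cone ?M) \<gamma> 1 2"
    by (rule smooth_arc_segment[of _ _ _ z 1 "y - z"]) (use False assms in \<open>auto simp: \<gamma>_def causal_le_def\<close>)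
  ultimately have "causal_arc ?M \<gamma> 0 2"
    unfolding causal_arc_def by (meson piecewise_smooth_arc.intros)
  moreover have "\<gamma> 0 = x" "\<gamma> 1 = z" "\<gamma> 2 = y" by (auto simp: \<gamma>_def)
  ultimately have "\<gamma> ` {0..2} \<subseteq> \<Omega>" using cc assms unfolding causally_convex_def by blast
  then show ?thesis using \<open>\<gamma> 1 = z\<close> by (auto simp: image_subset_iff dest: bspec[of _ _ 1])
qed (use assms(2,3) in auto)

section \<open>Limits of bounded causal curves\<close>

lemma tendsto_SUP_at_top:
  fixes f :: "real \<Rightarrow> real"
  assumes "\<And>s t. s \<le> t \<Longrightarrow> f s \<le> f t" "bdd_above (range f)"
  shows "(f \<longlongrightarrow> (SUP s. f s)) at_top"
proof (rule increasing_tendsto)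
  show "eventually (\<lambda>s. f s \<le> (SUP s. f s)) at_top"
    using assms(2) by (simp add: cSUP_upper)
next
  fix x assume "x < (SUP s. f s)"
  then obtain s where "x < f s" using less_cSUP_iff[OF _ assms(2)] by auto
  then show "eventually (\<lambda>s. x < f s) at_top"
    using assms(1) by (auto simp: eventually_at_top_linorder intro!: exI[of _ s] intro: less_le_trans)
qed

text \<open>Besides time, also time minus any spatial coordinate is nondecreasing along a future
  causal curve, since a coordinate is bounded by the norm. These bounded monotone functions
  converge, and their differences give the spatial coordinates.\<close>

lemma causal_curve_limit_at_top:
  fixes \<gamma> :: "real \<Rightarrow> 'n::finite mink"
  assumes mono: "\<And>s t. s < t \<Longrightarrow> causal_le (\<gamma> s) (\<gamma> t)" and bdd: "bounded (range \<gamma>)"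
  obtains c where "(\<gamma> \<longlongrightarrow> c) at_top"
proof -
  have mono': "causal_le (\<gamma> s) (\<gamma> t)" if "s \<le> t" for s t
    using mono[of s t] that by (cases "s = t") auto
  obtain M where M: "\<And>s. norm (\<gamma> s) \<le> M" using bdd by (auto simp: bounded_iff)
  have fM: "\<bar>fst (\<gamma> s)\<bar> \<le> M" for s
    using norm_fst_le[of "fst (\<gamma> s)" "snd (\<gamma> s)"] M[of s] by simp
  have sM: "\<bar>snd (\<gamma> s) $ i\<bar> \<le> M" for s i
    using norm_snd_le[of "snd (\<gamma> s)" "fst (\<gamma> s)"] M[of s] component_le_norm_cart[of "snd (\<gamma> s)" i] by simp
  have f: "((\<lambda>s. fst (\<gamma> s)) \<longlongrightarrow> (SUP s. fst (\<gamma> s))) at_top" (is "(_ \<longlongrightarrow> ?T) _")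
  proof (rule tendsto_SUP_at_top)
    show "fst (\<gamma> s) \<le> fst (\<gamma> t)" if "s \<le> t" for s t
      using order_trans[OF norm_ge_zero mono'[OF that, unfolded causal_le_def]] by simp
    show "bdd_above (range (\<lambda>s. fst (\<gamma> s)))"
      using fM by (intro bdd_aboveI[of _ M]) (auto simp: abs_le_iff)
  qed
  have g: "((\<lambda>s. fst (\<gamma> s) - snd (\<gamma> s) $ i) \<longlongrightarrow> (SUP s. fst (\<gamma> s) - snd (\<gamma> s) $ i)) at_top"
    (is "(_ \<longlongrightarrow> ?S i) _") for i
  proof (rule tendsto_SUP_at_top)
    show "fst (\<gamma> s) - snd (\<gamma> s) $ i \<le> fst (\<gamma> t) - snd (\<gamma> t) $ i" if "s \<le> t" for s t
      using mono'[OF that] component_le_norm_cart[of "snd (\<gamma> t - \<gamma> s)" i]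
      unfolding causal_le_def by simp
    show "bdd_above (range (\<lambda>s. fst (\<gamma> s) - snd (\<gamma> s) $ i))"
    proof (rule bdd_aboveI)
      fix y assume "y \<in> range (\<lambda>s. fst (\<gamma> s) - snd (\<gamma> s) $ i)"
      then obtain s where "y = fst (\<gamma> s) - snd (\<gamma> s) $ i" by blast
      then show "y \<le> M + M" using fM[of s] sM[of s i] by linarith
    qed
  qed
  have "((\<lambda>s. snd (\<gamma> s)) \<longlongrightarrow> (\<chi> i. ?T - ?S i)) at_top"
  proof (rule vec_tendstoI)
    fix i
    show "((\<lambda>s. snd (\<gamma> s) $ i) \<longlongrightarrow> (\<chi> i. ?T - ?S i) $ i) at_top"
      using tendsto_diff[OF f g[of i]] by simp
  qed
  then have "((\<lambda>s. (fst (\<gamma> s), snd (\<gamma> s))) \<longlongrightarrow> (?T, \<chi> i. ?T - ?S i)) at_top"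
    by (intro tendsto_Pair f)
  then show thesis using that by simp
qed

lemma causal_le_limit_at_top:
  fixes \<gamma> :: "real \<Rightarrow> 'n::finite mink"
  assumes "\<And>s t. s < t \<Longrightarrow> causal_le (\<gamma> s) (\<gamma> t)" "(\<gamma> \<longlongrightarrow> c) at_top"
  shows "causal_le (\<gamma> s) c"
proof -
  have "eventually (\<lambda>t. \<gamma> t \<in> {y. causal_le (\<gamma> s) y}) at_top"
    using eventually_gt_at_top[of s] by eventually_elim (use assms(1) in auto)
  then show ?thesis using Lim_in_closed_set[OF closed_causal_le_above _ _ assms(2)] by auto
qed

lemma causal_curve_limit_at_bot:
  fixes \<gamma> :: "real \<Rightarrow> 'n::finite mink"
  assumes mono: "\<And>s t. s < t \<Longrightarrow> causal_le (\<gamma> s) (\<gamma> t)" and bdd: "bounded (range \<gamma>)"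
  obtains c where "(\<gamma> \<longlongrightarrow> c) at_bot"
proof -
  \<comment> \<open>Negating both the parameter and the point preserves the causal order and
    exchanges the two ends.\<close>
  define \<beta> where "\<beta> s = - \<gamma> (- s)" for s
  have "causal_le (\<beta> s) (\<beta> t)" if "s < t" for s t
    using mono[of "-t" "-s"] that by (simp add: \<beta>_def causal_le_def)
  moreover have "bounded (range \<beta>)"
    using bdd by (auto simp: bounded_iff \<beta>_def)
  ultimately obtain c where "(\<beta> \<longlongrightarrow> c) at_top" using causal_curve_limit_at_top by blast
  then have "((\<lambda>s. \<gamma> (- s)) \<longlongrightarrow> - c) at_top"
    using tendsto_minus by (fastforce simp: \<beta>_def)
  then show thesis using that by (simp add: filterlim_at_bot_mirror)
qed

lemma causal_le_limit_at_bot: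
  fixes \<gamma> :: "real \<Rightarrow> 'n::finite mink"
  assumes "\<And>s t. s < t \<Longrightarrow> causal_le (\<gamma> s) (\<gamma> t)" "(\<gamma> \<longlongrightarrow> c) at_bot"
  shows "causal_le c (\<gamma> s)"
proof -
  have "eventually (\<lambda>t. \<gamma> t \<in> {y. causal_le y (\<gamma> s)}) at_bot"
    using eventually_gt_at_bot[of s] by eventually_elim (use assms(1) in auto)
  then show ?thesis using Lim_in_closed_set[OF closed_causal_le_below _ _ assms(2)] by auto
qed

text \<open>Restates inextensibility in the ambient space: a limit may exist, but only outside
  \<open>W\<close>. For bounded \<open>W\<close> both limits do exist, so this is the form that can
  be exploited.\<close>

lemma inextensible_curve_mink:
  fixes \<gamma> :: "real \<Rightarrow> 'n::finite mink"
  assumes "inextensible_causal_curve (mink_spacetime W) \<gamma>"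
  obtains \<sigma> :: real where "\<sigma> \<in> {1, -1}" "range \<gamma> \<subseteq> W" "continuous_on UNIV \<gamma>"
    "\<And>s t. s < t \<Longrightarrow> causal_order \<sigma> (\<gamma> s) (\<gamma> t)"
    "\<And>p F. F \<in> {at_top, at_bot} \<Longrightarrow> (\<gamma> \<longlongrightarrow> p) F \<Longrightarrow> p \<notin> W"
proof -
  obtain \<sigma> :: real where \<sigma>: "\<sigma> \<in> {1, -1}"
    and arcs: "\<And>a b. a < b \<Longrightarrow> piecewise_smooth_arc (mink_spacetime W) (cone_of_sign \<sigma> (mink_spacetime W)) \<gamma> a b"
  proof -
    from assms consider "\<forall>a b. a < b \<longrightarrow> piecewise_smooth_arc (mink_spacetime W) (future_cone (mink_spacetime W)) \<gamma> a b"
      | "\<forall>a b. a < b \<longrightarrow> piecewise_smooth_arc (mink_spacetime W) (past_cone (mink_spacetime W)) \<gamma> a b"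
      unfolding inextensible_causal_curve_def by blast
    then show thesis
    proof cases
      case 1 then show thesis using that[of 1] by (simp add: cone_of_sign_def)
    next
      case 2 then show thesis using that[of "-1"] by (simp add: cone_of_sign_def)
    qed
  qed
  note arcD = piecewise_smooth_arc_causal_order[OF \<sigma> arcs]
  have "\<gamma> s \<in> W" for s using arcD[of s "s + 1"] by auto
  then have W: "range \<gamma> \<subseteq> W" by auto
  have "isCont \<gamma> s" for s
    using arcD[of "s - 1" "s + 1"] by (intro continuous_on_interior[of "{s-1..s+1}"]) auto
  then have cont: "continuous_on UNIV \<gamma>" by (simp add: continuous_at_imp_continuous_on)
  have order: "causal_order \<sigma> (\<gamma> s) (\<gamma> t)" if "s < t" for s t using arcD[OF that] that by auto
  have "p \<notin> W" if F: "F \<in> {at_top, at_bot}" and p: "(\<gamma> \<longlongrightarrow> p) F" for p F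
  proof
    assume "p \<in> W"
    then have "limitin (topo (mink_spacetime W)) \<gamma> p F"
      using p W by (auto simp: limitin_subtopology image_subset_iff)
    then show False using F assms unfolding inextensible_causal_curve_def by blast
  qed
  then show thesis using that[OF \<sigma> W cont order] by blast
qed


section \<open>Cauchy hypersurfaces of bounded domains\<close>

text \<open>The exponential weights make this strictly increasing along causal curves, which the
  distances to the complements of \<open>F\<close> and \<open>P\<close> alone are not.\<close>
definition height :: "'n::finite mink set \<Rightarrow> 'n mink set \<Rightarrow> 'n mink \<Rightarrow> real" where
  "height F P x = exp (fst x) * infdist x (- F) - exp (- fst x) * infdist x (- P)"

lemma continuous_on_height: "continuous_on A (height F P)"
  unfolding height_def by (intro continuous_intros)

text \<open>Translation by \<open>x - y\<close> takes \<open>y\<close> to \<open>x\<close> and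
  \<open>A\<close> into itself, so every point of \<open>A\<close> has a counterpart as far from
  \<open>x\<close> as the point is from \<open>y\<close>.\<close>

lemma infdist_translate_le:
  fixes A :: "'a::real_normed_vector set"
  assumes "A \<noteq> {}" "\<And>z. z \<in> A \<Longrightarrow> z + (x - y) \<in> A"
  shows "infdist x A \<le> infdist y A"
proof -
  have "infdist x A \<le> dist y z" if "z \<in> A" for z
  proof -
    have "dist x (z + (x - y)) = dist y z" by (simp add: dist_norm)
    then show ?thesis using infdist_le[OF assms(2)[OF that], of x] by simp
  qed
  then show ?thesis unfolding infdist_notempty[OF assms(1), of y] using assms(1) by (intro cINF_greatest)
qed

text \<open>Abstracts the chronological future and past of a domain. Properness keeps the
  complements nonempty; \<open>infdist\<close> to the empty set would be 0 by convention.\<close>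

locale past_future_sets =
  fixes F P :: "'n::finite mink set"
  assumes open_F: "open F" and open_P: "open P" and F_proper: "F \<noteq> UNIV" and P_proper: "P \<noteq> UNIV"
    and up: "\<And>x y. x \<in> F \<Longrightarrow> causal_le x y \<Longrightarrow> y \<in> F"
    and down: "\<And>x y. y \<in> P \<Longrightarrow> causal_le x y \<Longrightarrow> x \<in> P"
begin

lemma infdist_F_pos: "x \<in> F \<Longrightarrow> 0 < infdist x (- F)"
  using infdist_pos_not_in_closed[of "- F" x] open_F F_proper by (auto simp: closed_Compl)

lemma infdist_P_pos: "x \<in> P \<Longrightarrow> 0 < infdist x (- P)"
  using infdist_pos_not_in_closed[of "- P" x] open_P P_proper by (auto simp: closed_Compl)

lemma height_pos: "x \<in> F \<Longrightarrow> x \<notin> P \<Longrightarrow> 0 < height F P x"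
  using infdist_F_pos by (simp add: height_def)

lemma height_neg: "x \<notin> F \<Longrightarrow> x \<in> P \<Longrightarrow> height F P x < 0"
  using infdist_P_pos by (simp add: height_def)

text \<open>Translating by a past causal vector preserves the complement of \<open>F\<close>, so the
  distance to it does not decrease on the way up; dually, the distance to the complement of
  \<open>P\<close> does not increase. Where the first distance is positive, that is on
  \<open>F\<close>, its weight makes the growth strict.\<close>

lemma height_strict_mono:
  assumes "x \<in> F" "causal_le x y" "x \<noteq> y"
  shows "height F P x < height F P y"
proof -
  have lt: "fst x < fst y" by (rule causal_le_fst_less[OF assms(2,3)])
  have "infdist x (- F) \<le> infdist y (- F)"
  proof (rule infdist_translate_le)
    fix z assume z: "z \<in> - F"
    have "causal_le (z + (x - y)) z" using assms(2) by (simp add: causal_le_def)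
    then show "z + (x - y) \<in> - F" using up z by blast
  qed (use F_proper in auto)
  moreover have "exp (fst x) * infdist x (- F) < exp (fst y) * infdist x (- F)"
    using lt infdist_F_pos[OF assms(1)] by simp
  ultimately have 1: "exp (fst x) * infdist x (- F) < exp (fst y) * infdist y (- F)"
    by (smt (verit) exp_gt_zero mult_left_mono)
  have "infdist y (- P) \<le> infdist x (- P)"
  proof (rule infdist_translate_le)
    fix z assume z: "z \<in> - P"
    have "causal_le z (z + (y - x))" using assms(2) by (simp add: causal_le_def)
    then show "z + (y - x) \<in> - P" using down z by blast
  qed (use P_proper in auto)
  then have "exp (- fst y) * infdist y (- P) \<le> exp (- fst x) * infdist x (- P)"
    using lt by (intro mult_mono) (auto simp: infdist_nonneg)
  then show ?thesis using 1 by (simp add: height_def)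
qed

text \<open>The map \<open>(height, snd)\<close> straightens the zero set. It is injective because
  points with equal \<open>snd\<close> lie on one vertical line, along which the height strictly
  increases; invariance of domain then makes it a chart.\<close>

lemma topological_hypersurface_height:
  assumes "open W" "W \<subseteq> F"
  shows "topological_hypersurface (mink_spacetime W) {x \<in> W. height F P x = 0}"
proof -
  define \<phi> where "\<phi> x = (height F P x, snd x)" for x
  have cont: "continuous_on W \<phi>"
    unfolding \<phi>_def by (intro continuous_intros continuous_on_height)
  have inj: "inj_on \<phi> W"
  proof (rule inj_onI)
    fix x y assume xy: "x \<in> W" "y \<in> W" "\<phi> x = \<phi> y"
    then have eq: "snd x = snd y" "height F P x = height F P y" by (auto simp: \<phi>_def)
    then have "causal_le x y \<or> causal_le y x" by (auto simp: causal_le_def)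
    then show "x = y" using height_strict_mono[of x y] height_strict_mono[of y x] xy assms(2) eq by auto
  qed
  obtain g where "homeomorphism W (\<phi> ` W) \<phi> g"
    using invariance_of_domain_homeomorphism[OF assms(1) cont _ inj] by auto
  then have "homeomorphic_map (top_of_set W) (top_of_set (\<phi> ` W)) \<phi>"
    unfolding homeomorphic_map_maps homeomorphic_maps_def homeomorphism_def
    by (intro exI[of _ g]) (auto simp: continuous_map_in_subtopology)
  moreover have "open (\<phi> ` W)" using invariance_of_domain[OF cont assms(1) inj] .
  moreover have "\<phi> ` (W \<inter> {x \<in> W. height F P x = 0}) = {x \<in> \<phi> ` W. fst x = 0}"
    by (auto simp: \<phi>_def)
  ultimately show ?thesis
    unfolding topological_hypersurface_def
    by (intro conjI ballI, simp, rule_tac exI[of _ W], rule_tac exI[of _ "\<phi> ` W"], rule_tac exI[of _ \<phi>])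
      (auto simp: subtopology_subtopology)
qed

text \<open>The last hypothesis says that the new domain acquires no past boundary point outside the
  past of the old one, so that every past inextensible curve still passes through the old domain.\<close>
lemma cauchy_hypersurface_height:
  assumes P': "open P'" "\<And>x y. y \<in> P' \<Longrightarrow> causal_le x y \<Longrightarrow> x \<in> P'" "P \<subseteq> P'"
    and bdd: "bounded (F \<inter> P')" and edge: "P' \<inter> closure F \<subseteq> P \<union> F"
  shows "cauchy_hypersurface (mink_spacetime (F \<inter> P')) {x \<in> F \<inter> P. height F P x = 0}"
proof -
  define W where "W = F \<inter> P'"
  have W: "open W" "W \<subseteq> F" using open_F P' by (auto simp: W_def)
  \<comment> \<open>On \<open>F\<close> outside \<open>P\<close> the height is positive, so
    enlarging \<open>P\<close> to \<open>P'\<close> creates no new zeros.\<close>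
  have S: "{x \<in> F \<inter> P. height F P x = 0} = {x \<in> W. height F P x = 0}"
    using height_pos P'(3) by (force simp: W_def)
  have "\<exists>!s. \<gamma> s \<in> {x \<in> W. height F P x = 0}"
    if \<gamma>: "inextensible_causal_curve (mink_spacetime W) \<gamma>" for \<gamma>
  proof -
    obtain \<sigma> :: real where \<sigma>: "\<sigma> \<in> {1, -1}" and \<gamma>W: "range \<gamma> \<subseteq> W" and cont: "continuous_on UNIV \<gamma>"
      and order: "\<And>s t. s < t \<Longrightarrow> causal_order \<sigma> (\<gamma> s) (\<gamma> t)"
      and nolim: "\<And>p F. F \<in> {at_top, at_bot} \<Longrightarrow> (\<gamma> \<longlongrightarrow> p) F \<Longrightarrow> p \<notin> W"
      using inextensible_curve_mink[OF \<gamma>] by blast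
    \<comment> \<open>Reversing the parameter if necessary makes the curve future directed.\<close>
    define \<beta> where "\<beta> s = \<gamma> (\<sigma> * s)" for s
    have lt: "causal_le (\<beta> s) (\<beta> t) \<and> \<beta> s \<noteq> \<beta> t" if "s < t" for s t
      using \<sigma> order[of s t] order[of "-t" "-s"] that by (auto simp: \<beta>_def)
    have le: "causal_le (\<beta> s) (\<beta> t)" if "s < t" for s t using lt[OF that] by blast
    have \<beta>W: "\<beta> s \<in> W" for s using \<gamma>W by (auto simp: \<beta>_def)
    have \<beta>cont: "continuous_on UNIV \<beta>"
      unfolding \<beta>_def by (intro continuous_on_compose2[OF cont] continuous_intros) auto
    have \<beta>nolim: "p \<notin> W" if "G \<in> {at_top, at_bot}" "(\<beta> \<longlongrightarrow> p) G" for p G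
    proof (cases "\<sigma> = 1")
      case True
      then have "\<beta> = \<gamma>" by (simp add: \<beta>_def fun_eq_iff)
      then show ?thesis using that nolim[of G p] by simp
    next
      case False
      then have \<beta>: "\<beta> = (\<lambda>s. \<gamma> (- s))" using \<sigma> by (auto simp: \<beta>_def)
      have "(\<gamma> \<longlongrightarrow> p) at_bot" if "(\<beta> \<longlongrightarrow> p) at_top"
        using that unfolding \<beta> by (subst filterlim_at_bot_mirror)
      moreover have "(\<gamma> \<longlongrightarrow> p) at_top" if "(\<beta> \<longlongrightarrow> p) at_bot"
        using that unfolding \<beta> by (subst filterlim_at_top_mirror)
      ultimately show ?thesis using that nolim[of at_top p] nolim[of at_bot p] by blast
    qed
    have bdd\<beta>: "bounded (range \<beta>)" using bdd bounded_subset \<beta>W unfolding W_def by (metis image_subsetI)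
    have strict: "height F P (\<beta> s) < height F P (\<beta> t)" if "s < t" for s t
      using height_strict_mono lt[OF that] \<beta>W W by blast
    have hcont: "((\<lambda>s. height F P (\<beta> s)) \<longlongrightarrow> height F P c) G" if "(\<beta> \<longlongrightarrow> c) G" for c G
      using continuous_on_tendsto_compose[OF continuous_on_height[of UNIV] that] by simp
    \<comment> \<open>The future limit stays in the future set \<open>F\<close> but leaves
      \<open>W\<close>, hence lies outside \<open>P'\<close> and \<open>P\<close>: the height is
      positive there.\<close>
    obtain c where c: "(\<beta> \<longlongrightarrow> c) at_top" using causal_curve_limit_at_top[OF le bdd\<beta>] by blast
    have "causal_le (\<beta> 0) c" using causal_le_limit_at_top[OF le c] .
    then have "c \<in> F" using up \<beta>W[of 0] W by blast
    moreover from this have "c \<notin> P" using \<beta>nolim[OF _ c] P'(3) by (auto simp: W_def)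
    ultimately have "0 < height F P c" by (rule height_pos)
    then have "eventually (\<lambda>s. 0 < height F P (\<beta> s)) at_top" using order_tendstoD(1)[OF hcont[OF c]] by blast
    then obtain t where t: "0 < height F P (\<beta> t)" by (meson eventually_at_top_linorder order_refl)
    \<comment> \<open>The past limit stays in \<open>P'\<close> but leaves \<open>W\<close>, hence
      lies outside \<open>F\<close>. As it is in the closure of \<open>F\<close>, the hypothesis
      \<open>edge\<close> puts it into \<open>P\<close>, where the height is negative.\<close>
    obtain a where a: "(\<beta> \<longlongrightarrow> a) at_bot" using causal_curve_limit_at_bot[OF le bdd\<beta>] by blast
    have "causal_le a (\<beta> 0)" using causal_le_limit_at_bot[OF le a] .
    then have aP': "a \<in> P'" using P'(2)[of "\<beta> 0" a] \<beta>W[of 0] by (simp add: W_def)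
    then have aF: "a \<notin> F" using \<beta>nolim[OF _ a] by (auto simp: W_def)
    have "a \<in> closure F"
      by (rule Lim_in_closed_set[OF closed_closure _ _ a])
        (use \<beta>W W closure_subset in \<open>auto intro!: always_eventually\<close>)
    then have "a \<in> P" using edge aP' aF by auto
    then have "height F P a < 0" using height_neg aF by blast
    then have "eventually (\<lambda>s. height F P (\<beta> s) < 0) at_bot" using order_tendstoD(2)[OF hcont[OF a]] by blast
    then obtain s where s: "height F P (\<beta> s) < 0" by (meson eventually_at_bot_linorder order_refl)
    have "s < t" using strict[of t s] s t by (cases s t rule: linorder_cases) auto
    moreover have "continuous_on {s..t} (\<lambda>s. height F P (\<beta> s))"
      by (rule continuous_on_compose2[OF continuous_on_height[of UNIV] continuous_on_subset[OF \<beta>cont]]) auto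
    ultimately obtain u where u: "height F P (\<beta> u) = 0"
      using IVT'[of "\<lambda>s. height F P (\<beta> s)" s 0 t] s t by auto
    have uniq: "v = u" if "height F P (\<beta> v) = 0" for v
      using strict[of u v] strict[of v u] that u by (cases u v rule: linorder_cases) auto
    have \<gamma>: "\<gamma> v = \<beta> (\<sigma> * v)" for v using \<sigma> by (auto simp: \<beta>_def)
    show ?thesis
    proof (rule ex1I[of _ "\<sigma> * u"])
      show "\<gamma> (\<sigma> * u) \<in> {x \<in> W. height F P x = 0}" using u \<beta>W by (simp add: \<beta>_def[symmetric])
      show "v = \<sigma> * u" if "\<gamma> v \<in> {x \<in> W. height F P x = 0}" for v
        using uniq[of "\<sigma> * v"] that \<sigma> unfolding \<gamma> by auto
    qed
  qed
  then show ?thesis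
    using topological_hypersurface_height[OF W] unfolding S cauchy_hypersurface_def W_def[symmetric] by blast
qed

end

section \<open>Cauchy extensions obtained by enlarging the past set\<close>

lemma bounded_causal_between:
  fixes A B :: "'n::finite mink set"
  assumes "bounded A" "bounded B"
  shows "bounded {x. \<exists>y\<in>A. \<exists>z\<in>B. causal_le y x \<and> causal_le x z}"
proof -
  obtain M where M: "\<And>y. y \<in> A \<Longrightarrow> norm y \<le> M" using assms(1) by (auto simp: bounded_iff)
  obtain N where N: "\<And>z. z \<in> B \<Longrightarrow> norm z \<le> N" using assms(2) by (auto simp: bounded_iff)
  have "norm x \<le> 3 * M + 2 * N"
    if yz: "y \<in> A" "z \<in> B" "causal_le y x" "causal_le x z" for x y z :: "'n mink"
  proof -
    have y: "norm (fst y) \<le> M" "norm (snd y) \<le> M"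
      using M[OF yz(1)] norm_fst_le[of "fst y" "snd y"] norm_snd_le[of "snd y" "fst y"] by simp_all
    have z: "norm (fst z) \<le> N" using N[OF yz(2)] norm_fst_le[of "fst z" "snd z"] by simp
    have yx: "norm (snd x - snd y) \<le> fst x - fst y" using yz(3) by (simp add: causal_le_def)
    have xz: "norm (snd z - snd x) \<le> fst z - fst x" using yz(4) by (simp add: causal_le_def)
    have "fst y \<le> fst x" "fst x \<le> fst z" using order_trans[OF norm_ge_zero yx] order_trans[OF norm_ge_zero xz] by auto
    then have "norm (fst x) \<le> M + N" using y(1) z by auto
    moreover have "norm (snd x) \<le> norm (snd y) + norm (snd x - snd y)" by (rule norm_triangle_sub)
    then have "norm (snd x) \<le> 2 * M + N" using y z yx \<open>fst x \<le> fst z\<close> by auto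
    moreover have "norm x \<le> norm (fst x) + norm (snd x)" using norm_Pair_le[of "fst x" "snd x"] by simp
    ultimately show ?thesis by simp
  qed
  then show ?thesis by (intro boundedI[of _ "3 * M + 2 * N"]) blast
qed

text \<open>Otherwise adding the past of a point slightly above \<open>b\<close> would give a domain with the same
  Cauchy hypersurface.\<close>
lemma C_maximal_edge:
  fixes \<Omega> :: "'n::finite mink set"
  assumes op: "open \<Omega>" and bdd: "bounded \<Omega>" and cc: "causally_convex \<Omega>"
    and cmax: "C_maximal (mink_spacetime \<Omega>)" and b: "b \<in> chron_future \<Omega>" "b \<notin> \<Omega>"
  shows "\<exists>q. causal_le q b \<and> q \<notin> chron_past \<Omega> \<and> q \<notin> chron_future \<Omega>"
proof -
  define F where "F = chron_future \<Omega>"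
  define P where "P = chron_past \<Omega>"
  obtain M where M: "\<And>y. y \<in> \<Omega> \<Longrightarrow> norm y \<le> M" using bdd by (auto simp: bounded_iff)
  have fM: "\<bar>fst y\<bar> \<le> M" if "y \<in> \<Omega>" for y
    using M[OF that] norm_fst_le[of "fst y" "snd y"] by simp
  have chron_fst: "fst x < fst y" if "chron x y" for x y :: "'n mink"
    using that le_less_trans[OF norm_ge_zero] unfolding chron_def by fastforce
  interpret past_future_sets F P
  proof
    show "open F" "open P" by (simp_all add: F_def P_def open_chron_future open_chron_past)
    have "(- M - 1, 0) \<notin> F"
      using fM chron_fst unfolding F_def chron_future_def by fastforce
    then show "F \<noteq> UNIV" by blast
    have "(M + 1, 0) \<notin> P"
      using fM chron_fst unfolding P_def chron_past_def by fastforce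
    then show "P \<noteq> UNIV" by blast
    show "y \<in> F" if "x \<in> F" "causal_le x y" for x y using that chron_future_up by (simp add: F_def)
    show "x \<in> P" if "y \<in> P" "causal_le x y" for x y using that chron_past_down by (simp add: P_def)
  qed
  have \<Omega>: "\<Omega> = F \<inter> P"
  proof
    show "\<Omega> \<subseteq> F \<inter> P"
      using open_subset_chron_future[OF op] open_subset_chron_past[OF op] by (simp add: F_def P_def)
    show "F \<inter> P \<subseteq> \<Omega>"
    proof
      fix x assume "x \<in> F \<inter> P"
      then obtain y z where "y \<in> \<Omega>" "z \<in> \<Omega>" "chron y x" "chron x z"
        unfolding F_def P_def chron_future_def chron_past_def by blast
      then show "x \<in> \<Omega>" using causally_convexD[OF cc] chron_imp_causal_le by blast
    qed
  qed
  \<comment> \<open>Without such a point the hypothesis \<open>edge\<close> of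
    \<open>cauchy_hypersurface_height\<close> holds for the enlarged past set, and the inclusion is
    a Cauchy embedding that misses \<open>b\<close>.\<close>
  have *: "\<exists>a. causal_le a (b + (s, 0)) \<and> a \<in> closure F \<and> a \<notin> F \<and> a \<notin> P" if s: "0 < s" for s
  proof (rule ccontr)
    assume no: "\<nexists>a. causal_le a (b + (s, 0)) \<and> a \<in> closure F \<and> a \<notin> F \<and> a \<notin> P"
    \<comment> \<open>The relation \<open>chron\<close> is strict: only the past of a point above
      \<open>b\<close> contains \<open>b\<close> itself.\<close>
    define P' where "P' = chron_past (insert (b + (s, 0)) \<Omega>)"
    have P': "P' = P \<union> chron_past {b + (s, 0)}"
      unfolding P'_def P_def using chron_past_Un[of "{b + (s, 0)}" \<Omega>] by auto
    have sub: "F \<inter> P' \<subseteq> {x. \<exists>y\<in>\<Omega>. \<exists>z\<in>insert (b + (s, 0)) \<Omega>. causal_le y x \<and> causal_le x z}"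
      unfolding F_def P'_def chron_future_def chron_past_def using chron_imp_causal_le by blast
    have bd: "bounded (F \<inter> P')"
      by (rule bounded_subset[OF bounded_causal_between sub]) (use bdd in simp_all)
    have edge: "P' \<inter> closure F \<subseteq> P \<union> F"
    proof
      fix x assume x: "x \<in> P' \<inter> closure F"
      show "x \<in> P \<union> F"
      proof (rule ccontr)
        assume "x \<notin> P \<union> F"
        then have "chron x (b + (s, 0))" using x unfolding P' by (simp add: chron_past_def)
        then show False using no x \<open>x \<notin> P \<union> F\<close> chron_imp_causal_le by blast
      qed
    qed
    have S': "cauchy_hypersurface (mink_spacetime (F \<inter> P')) {x \<in> F \<inter> P. height F P x = 0}"
    proof (rule cauchy_hypersurface_height[OF _ _ _ bd edge])
      show "open P'" by (simp add: P'_def open_chron_past)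
      show "x \<in> P'" if "y \<in> P'" "causal_le x y" for x y
        using that chron_past_down by (simp add: P'_def)
      show "P \<subseteq> P'" by (simp add: P')
    qed
    have S: "cauchy_hypersurface (mink_spacetime \<Omega>) {x \<in> F \<inter> P. height F P x = 0}"
      unfolding \<Omega>
      by (rule cauchy_hypersurface_height[OF open_P down order_refl]) (use bdd \<Omega> in auto)
    have op': "open (F \<inter> P')" using open_F by (simp add: P'_def open_chron_past open_Int)
    have "globally_hyperbolic (mink_spacetime (F \<inter> P'))"
      unfolding globally_hyperbolic_def using S' conformal_spacetime_mink[OF op'] by blast
    moreover have "conformal_map (mink_spacetime \<Omega>) (mink_spacetime (F \<inter> P')) id"
      by (rule conformal_map_mink_inclusion[OF op]) (use \<Omega> P' in auto)
    then have "cauchy_embedding (mink_spacetime \<Omega>) (mink_spacetime (F \<inter> P')) id"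
      unfolding cauchy_embedding_def using S S'
      by (intro conjI exI[of _ "{x \<in> F \<inter> P. height F P x = 0}"]) auto
    ultimately have "id ` points (mink_spacetime \<Omega>) = points (mink_spacetime (F \<inter> P'))"
      using cmax unfolding C_maximal_def by blast
    then have "\<Omega> = F \<inter> P'" by simp
    moreover have "b \<in> F \<inter> P'"
      using b(1) chron_time_shift[OF s, of b] unfolding P' F_def chron_past_def by blast
    ultimately show False using b by blast
  qed
  \<comment> \<open>Let the shift above \<open>b\<close> tend to 0. The complements of
    \<open>F\<close> and \<open>P\<close> are closed, so a limit point of the \<open>a k\<close>
    stays outside both and lies causally below \<open>b\<close>.\<close>
  define s where "s k = 1 / real (Suc k)" for k
  have "\<exists>a. \<forall>k. causal_le (a k) (b + (s k, 0)) \<and> a k \<in> closure F \<and> a k \<notin> F \<and> a k \<notin> P"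
    by (rule choice) (use * in \<open>simp add: s_def\<close>)
  then obtain a where a: "\<And>k. causal_le (a k) (b + (s k, 0))" "\<And>k. a k \<in> closure F"
    "\<And>k. a k \<notin> F" "\<And>k. a k \<notin> P" by blast
  have "bounded (range a)"
  proof -
    \<comment> \<open>The point \<open>a k\<close> is only in the closure of \<open>F\<close>;
      raised by one unit of time it lies above a point of \<open>\<Omega>\<close>. As
      \<open>s k \<le> 1\<close>, it is then still below \<open>b + (2, 0)\<close>.\<close>
    have "\<exists>y\<in>\<Omega>. \<exists>z\<in>{b + (2, 0)}. causal_le y (a k + (1, 0)) \<and> causal_le (a k + (1, 0)) z" for k
    proof -
      have "{x. chron x (a k + (1, 0))} \<inter> closure F \<noteq> {}"
        using a(2)[of k] chron_time_shift[of 1 "a k", OF zero_less_one] by blast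
      then have "{x. chron x (a k + (1, 0))} \<inter> F \<noteq> {}"
        using open_Int_closure_eq_empty[OF open_chron_below] by blast
      then obtain y where "y \<in> \<Omega>" "causal_le y (a k + (1, 0))"
        unfolding F_def chron_future_def using chron_imp_causal_le causal_le_trans by blast
      moreover have "s k \<le> 1" by (simp add: s_def)
      then have "causal_le (a k + (1, 0)) (b + (2, 0))" using a(1)[of k] by (simp add: causal_le_def)
      ultimately show ?thesis by blast
    qed
    then have "range (\<lambda>k. a k + (1, 0)) \<subseteq>
        {x. \<exists>y\<in>\<Omega>. \<exists>z\<in>{b + (2, 0)}. causal_le y x \<and> causal_le x z}" by blast
    moreover have "bounded {x. \<exists>y\<in>\<Omega>. \<exists>z\<in>{b + (2, 0)}. causal_le y x \<and> causal_le x z}"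
      by (rule bounded_causal_between[OF bdd]) simp
    ultimately have "bounded (range (\<lambda>k. a k + (1, 0)))" by (rule bounded_subset[rotated])
    then have "bounded ((\<lambda>x. x - (1, 0)) ` range (\<lambda>k. a k + (1, 0)))"
      by (rule bounded_translation_minus)
    then show ?thesis by (simp add: image_image)
  qed
  then obtain q r where r: "strict_mono (r :: nat \<Rightarrow> nat)" and q: "(a \<circ> r) \<longlonglongrightarrow> q"
    using bounded_imp_convergent_subsequence by blast
  have "q \<in> - F" by (rule closed_sequentially[OF _ _ q]) (use open_F a in auto)
  moreover have "q \<in> - P" by (rule closed_sequentially[OF _ _ q]) (use open_P a in auto)
  moreover have "q \<in> {x. causal_le x b}"
  proof (rule closed_sequentially[OF closed_causal_le_below])
    have "s \<longlonglongrightarrow> 0" unfolding s_def by (rule LIMSEQ_Suc[OF lim_1_over_n])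
    then have "(\<lambda>k. (s (r k), 0 :: real ^ 'n)) \<longlonglongrightarrow> (0, 0)"
      using LIMSEQ_subseq_LIMSEQ[OF _ r] by (intro tendsto_Pair) (auto simp: o_def)
    then show "(\<lambda>k. a (r k) - (s (r k), 0)) \<longlonglongrightarrow> q"
      using tendsto_diff[OF q] by (fastforce simp: o_def zero_prod_def[symmetric])
    show "a (r k) - (s (r k), 0) \<in> {x. causal_le x b}" for k
      using a(1)[of "r k"] by (simp add: causal_le_def algebra_simps)
  qed
  ultimately show ?thesis unfolding F_def P_def by blast
qed


section \<open>Bounds for the Markowitz pseudodistance\<close>

lemma affine_nonzero_coeff:
  fixes c d :: real
  assumes "\<And>s. s \<in> {-1<..<1} \<Longrightarrow> c * s + d \<noteq> 0"
  shows "d \<noteq> 0" "\<bar>c\<bar> \<le> \<bar>d\<bar>"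
proof -
  show d: "d \<noteq> 0" using assms[of 0] by simp
  show "\<bar>c\<bar> \<le> \<bar>d\<bar>"
  proof (rule ccontr)
    assume "\<not> \<bar>c\<bar> \<le> \<bar>d\<bar>"
    then have c: "c \<noteq> 0" "\<bar>- d / c\<bar> < 1" by (auto simp: abs_divide)
    define u where "u = - d / c"
    have "u \<in> {-1<..<1}" using c(2) unfolding u_def[symmetric] greaterThanLessThan_iff by linarith
    then show False using assms[of u] c(1) by (simp add: u_def)
  qed
qed

lemma affine_pos:
  fixes c d s :: real
  assumes "0 < d" "\<bar>c\<bar> \<le> d" "s \<in> {-1<..<1}"
  shows "0 < c * s + d"
proof -
  have "\<bar>c * s\<bar> \<le> d * \<bar>s\<bar>" using assms by (simp add: abs_mult mult_right_mono)
  also have "\<dots> < d" using assms by auto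
  finally show ?thesis by linarith
qed

text \<open>Among the positive affine functions on the interval, \<open>1 + s\<close> has the
  fastest and \<open>1 - s\<close> the slowest logarithmic growth. After exponentiation both bounds
  say that \<open>(\<beta> - \<alpha>) * (s - t)\<close> and
  \<open>(\<beta> + \<alpha>) * (s - t)\<close> are nonnegative.\<close>

lemma ln_affine_diff:
  fixes \<alpha> \<beta> s t :: real
  assumes "0 < \<beta>" "\<bar>\<alpha>\<bar> \<le> \<beta>" "s \<in> {-1<..<1}" "t \<in> {-1<..<1}" "t \<le> s"
  shows "ln (\<alpha> * s + \<beta>) - ln (\<alpha> * t + \<beta>) \<le> ln (1 + s) - ln (1 + t)"
    "ln (1 - s) - ln (1 - t) \<le> ln (\<alpha> * s + \<beta>) - ln (\<alpha> * t + \<beta>)"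
proof -
  have pos: "0 < \<alpha> * s + \<beta>" "0 < \<alpha> * t + \<beta>" using affine_pos assms by blast+
  have "0 \<le> (\<beta> - \<alpha>) * (s - t)" "0 \<le> (\<beta> + \<alpha>) * (s - t)" using assms by auto
  then have "(\<alpha> * s + \<beta>) * (1 + t) \<le> (\<alpha> * t + \<beta>) * (1 + s)" "(\<alpha> * t + \<beta>) * (1 - s) \<le> (\<alpha> * s + \<beta>) * (1 - t)"
    by (auto simp: algebra_simps)
  then have "ln ((\<alpha> * s + \<beta>) * (1 + t)) \<le> ln ((\<alpha> * t + \<beta>) * (1 + s))"
    "ln ((\<alpha> * t + \<beta>) * (1 - s)) \<le> ln ((\<alpha> * s + \<beta>) * (1 - t))"
    using pos assms by (auto intro!: ln_mono mult_pos_pos)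
  then show "ln (\<alpha> * s + \<beta>) - ln (\<alpha> * t + \<beta>) \<le> ln (1 + s) - ln (1 + t)"
    "ln (1 - s) - ln (1 - t) \<le> ln (\<alpha> * s + \<beta>) - ln (\<alpha> * t + \<beta>)"
    using pos assms by (simp_all add: ln_mult_pos)
qed

text \<open>Exhibits \<open>rho\<close> as the distance on the line after the substitution
  \<open>ln ((1 + s) / (1 - s))\<close>.\<close>

lemma rho_eq:
  assumes "s \<in> {-1<..<1}" "t \<in> {-1<..<1}"
  shows "rho s t = \<bar>(ln (1 + s) - ln (1 - s)) - (ln (1 + t) - ln (1 - t))\<bar>"
proof -
  have "((s - 1) * (t + 1)) / ((s + 1) * (t - 1)) = ((1 - s) * (1 + t)) / ((1 + s) * (1 - t))"
  proof -
    have "(s - 1) * (t + 1) = - ((1 - s) * (1 + t))" "(s + 1) * (t - 1) = - ((1 + s) * (1 - t))"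
      by (simp_all add: algebra_simps)
    then show ?thesis by (simp only: minus_divide_divide)
  qed
  then show ?thesis using assms unfolding rho_def by (simp add: ln_div ln_mult_pos)
qed

text \<open>A Schwarz lemma for homographies from the interval to the positive half-line. Applying
  \<open>ln_affine_diff\<close> to numerator and denominator separately, the bounds add up exactly
  to \<open>rho\<close>.\<close>

lemma ln_homography_diff_le_rho:
  fixes a b c d s t :: real
  assumes pos: "\<And>u. u \<in> {-1<..<1} \<Longrightarrow> c * u + d \<noteq> 0 \<and> 0 < (a * u + b) / (c * u + d)"
    and st: "s \<in> {-1<..<1}" "t \<in> {-1<..<1}"
  shows "\<bar>ln ((a * s + b) / (c * s + d)) - ln ((a * t + b) / (c * t + d))\<bar> \<le> rho s t"
proof -
  have cd: "d \<noteq> 0" "\<bar>c\<bar> \<le> \<bar>d\<bar>" using affine_nonzero_coeff[of c d] pos by blast+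
  \<comment> \<open>Multiplying numerator and denominator by the sign \<open>e\<close> leaves the
    quotient unchanged and makes both positive.\<close>
  define e :: real where "e = (if 0 < d then 1 else - 1)"
  have e: "e \<noteq> 0" "e * d = \<bar>d\<bar>" "\<bar>e * c\<bar> \<le> \<bar>d\<bar>"
    using cd by (auto simp: e_def)
  have q: "0 < (e * c) * u + e * d" if "u \<in> {-1<..<1}" for u
    using affine_pos[of "e * d" "e * c" u] e cd that by auto
  have eq: "(a * u + b) / (c * u + d) = ((e * a) * u + e * b) / ((e * c) * u + e * d)" for u
    using e(1) by (simp add: mult.assoc distrib_left[symmetric])
  have p: "0 < (e * a) * u + e * b" if "u \<in> {-1<..<1}" for u
    using pos[OF that] q[OF that] unfolding eq by (simp add: zero_less_divide_iff)
  have ab: "0 < e * b" "\<bar>e * a\<bar> \<le> e * b"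
  proof -
    show "0 < e * b" using p[of 0] by simp
    then show "\<bar>e * a\<bar> \<le> e * b" using affine_nonzero_coeff(2)[of "e * a" "e * b"] p by fastforce
  qed
  have cd': "0 < e * d" "\<bar>e * c\<bar> \<le> e * d" using e cd by auto
  have lnq: "ln ((a * u + b) / (c * u + d)) = ln ((e * a) * u + e * b) - ln ((e * c) * u + e * d)"
    if "u \<in> {-1<..<1}" for u unfolding eq using p[OF that] q[OF that] by (simp add: ln_div)
  show ?thesis
    unfolding rho_eq[OF st] lnq[OF st(1)] lnq[OF st(2)]
  proof (cases "t \<le> s")
    case True
    show "\<bar>ln (e * a * s + e * b) - ln (e * c * s + e * d) - (ln (e * a * t + e * b) - ln (e * c * t + e * d))\<bar>
      \<le> \<bar>ln (1 + s) - ln (1 - s) - (ln (1 + t) - ln (1 - t))\<bar>"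
      using ln_affine_diff[OF ab st True] ln_affine_diff[OF cd' st True] by linarith
  next
    case False
    then have "s \<le> t" by simp
    show "\<bar>ln (e * a * s + e * b) - ln (e * c * s + e * d) - (ln (e * a * t + e * b) - ln (e * c * t + e * d))\<bar>
      \<le> \<bar>ln (1 + s) - ln (1 - s) - (ln (1 + t) - ln (1 - t))\<bar>"
      using ln_affine_diff[OF ab st(2,1) \<open>s \<le> t\<close>] ln_affine_diff[OF cd' st(2,1) \<open>s \<le> t\<close>] by linarith
  qed
qed

section \<open>Lower bounds from functions affine on lightlike lines\<close>

definition null_affine :: "('n::finite mink \<Rightarrow> real) \<Rightarrow> bool" where
  "null_affine f \<longleftrightarrow> (\<forall>x v. lightlike v \<longrightarrow> (\<exists>A B. \<forall>r. f (x + r *\<^sub>R v) = A + B * r))"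

text \<open>Along the geodesic, \<open>f\<close> is an affine function of a homography, hence again
  a quotient of affine functions with the same denominator.\<close>

lemma null_affine_geodesic_le_rho:
  assumes f: "null_affine f" "\<And>x. x \<in> \<Omega> \<Longrightarrow> 0 < f x"
    and \<gamma>: "proj_lightlike_geodesic \<Omega> \<gamma>" and st: "s \<in> {-1<..<1}" "t \<in> {-1<..<1}"
  shows "\<bar>ln (f (\<gamma> s)) - ln (f (\<gamma> t))\<bar> \<le> rho s t"
proof -
  obtain x v a b c d where v: "lightlike v" and
    g: "\<And>u. u \<in> {-1<..<1} \<Longrightarrow> c * u + d \<noteq> 0 \<and> \<gamma> u = x + ((a * u + b) / (c * u + d)) *\<^sub>R v \<and> \<gamma> u \<in> \<Omega>"
    using \<gamma> unfolding proj_lightlike_geodesic_def by blast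
  obtain A B where AB: "\<And>r. f (x + r *\<^sub>R v) = A + B * r" using f(1) v unfolding null_affine_def by blast
  have fg: "f (\<gamma> u) = ((A * c + B * a) * u + (A * d + B * b)) / (c * u + d)" if "u \<in> {-1<..<1}" for u
    using g[OF that] by (simp add: AB field_simps)
  have pos: "c * u + d \<noteq> 0 \<and> 0 < ((A * c + B * a) * u + (A * d + B * b)) / (c * u + d)"
    if "u \<in> {-1<..<1}" for u
    using g[OF that] f(2)[of "\<gamma> u"] unfolding fg[OF that] by blast
  show ?thesis
    unfolding fg[OF st(1)] fg[OF st(2)] by (rule ln_homography_diff_le_rho[OF pos st])
qed

definition chain_lengths :: "'n::finite mink set \<Rightarrow> 'n mink \<Rightarrow> 'n mink \<Rightarrow> real set" where
  "chain_lengths \<Omega> x y = {(\<Sum>k=1..m. rho (s k) (t k)) | m \<gamma> s t. m \<ge> (1::nat) \<and>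
     (\<forall>k\<in>{1..m}. proj_lightlike_geodesic \<Omega> (\<gamma> k) \<and> s k \<in> {-1<..<1} \<and> t k \<in> {-1<..<1}) \<and>
     \<gamma> 1 (s 1) = x \<and> \<gamma> m (t m) = y \<and> (\<forall>k\<in>{1..<m}. \<gamma> k (t k) = \<gamma> (Suc k) (s (Suc k)))}"

lemma markowitz_eq: "x \<in> \<Omega> \<Longrightarrow> y \<in> \<Omega> \<Longrightarrow> markowitz \<Omega> x y = Inf (chain_lengths \<Omega> x y)"
  by (simp add: markowitz_def chain_lengths_def)

lemma chain_length_ge:
  assumes f: "null_affine f" "\<And>x. x \<in> \<Omega> \<Longrightarrow> 0 < f x" and l: "l \<in> chain_lengths \<Omega> x y"
  shows "\<bar>ln (f x) - ln (f y)\<bar> \<le> l"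
proof -
  obtain m \<gamma> s t where m: "m \<ge> (1::nat)" and l: "l = (\<Sum>k=1..m. rho (s k) (t k))"
    and g: "\<And>k. k \<in> {1..m} \<Longrightarrow> proj_lightlike_geodesic \<Omega> (\<gamma> k) \<and> s k \<in> {-1<..<1} \<and> t k \<in> {-1<..<1}"
    and ends: "\<gamma> 1 (s 1) = x" "\<gamma> m (t m) = y"
    and link: "\<And>k. k \<in> {1..<m} \<Longrightarrow> \<gamma> k (t k) = \<gamma> (Suc k) (s (Suc k))"
    using l unfolding chain_lengths_def by blast
  have edge: "\<bar>ln (f (\<gamma> k (s k))) - ln (f (\<gamma> k (t k)))\<bar> \<le> rho (s k) (t k)" if "k \<in> {1..m}" for k
    using null_affine_geodesic_le_rho[OF f] g[OF that] by blast
  have "\<bar>ln (f x) - ln (f (\<gamma> j (t j)))\<bar> \<le> (\<Sum>k=1..j. rho (s k) (t k))" if "1 \<le> j" "j \<le> m" for j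
    using that
  proof (induction j rule: dec_induct)
    case base
    then show ?case using edge[of 1] ends by simp
  next
    case (step j)
    have "j \<in> {1..<m}" "Suc j \<in> {1..m}" using step by auto
    then show ?case using step link edge[of "Suc j"] by force
  qed
  then show ?thesis using m ends l by auto
qed

text \<open>A nonempty set of chains is assumed because \<open>Inf\<close> of the empty set carries
  no information.\<close>

lemma markowitz_ge:
  assumes "null_affine f" "\<And>x. x \<in> \<Omega> \<Longrightarrow> 0 < f x" "x \<in> \<Omega>" "y \<in> \<Omega>" "chain_lengths \<Omega> x y \<noteq> {}"
  shows "\<bar>ln (f x) - ln (f y)\<bar> \<le> markowitz \<Omega> x y"
  unfolding markowitz_eq[OF assms(3,4)] using assms(5) by (intro cInf_greatest chain_length_ge[OF assms(1,2)])

section \<open>Explicit chains along lightlike segments\<close>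

lemma proj_lightlike_geodesic_mem: "proj_lightlike_geodesic \<Omega> \<gamma> \<Longrightarrow> s \<in> {-1<..<1} \<Longrightarrow> \<gamma> s \<in> \<Omega>"
  unfolding proj_lightlike_geodesic_def by blast

lemma markowitz_le_rho:
  assumes "proj_lightlike_geodesic \<Omega> \<gamma>" "s \<in> {-1<..<1}" "t \<in> {-1<..<1}"
  shows "markowitz \<Omega> (\<gamma> s) (\<gamma> t) \<le> rho s t"
proof -
  have "rho s t \<in> chain_lengths \<Omega> (\<gamma> s) (\<gamma> t)"
    unfolding chain_lengths_def using assms
    by (intro CollectI exI[of _ 1] exI[of _ "\<lambda>_. \<gamma>"] exI[of _ "\<lambda>_. s"] exI[of _ "\<lambda>_. t"]) auto
  moreover have "bdd_below (chain_lengths \<Omega> (\<gamma> s) (\<gamma> t))"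
    by (intro bdd_belowI[of _ 0]) (auto simp: chain_lengths_def rho_def intro!: sum_nonneg)
  ultimately show ?thesis
    using markowitz_eq proj_lightlike_geodesic_mem[OF assms(1)] assms(2,3) by (metis cInf_lower)
qed

lemma chain_lengths_two_ne:
  assumes "proj_lightlike_geodesic \<Omega> \<gamma>" "s \<in> {-1<..<1}" "t \<in> {-1<..<1}"
    "proj_lightlike_geodesic \<Omega> \<gamma>'" "s' \<in> {-1<..<1}" "t' \<in> {-1<..<1}" "\<gamma> t = \<gamma>' s'"
  shows "chain_lengths \<Omega> (\<gamma> s) (\<gamma>' t') \<noteq> {}"
proof -
  have "(\<Sum>k=1..(2::nat). rho (if k = 1 then s else s') (if k = 1 then t else t')) \<in> chain_lengths \<Omega> (\<gamma> s) (\<gamma>' t')"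
    unfolding chain_lengths_def
    by (rule CollectI, rule exI[of _ 2], rule exI[of _ "\<lambda>k. if k = 1 then \<gamma> else \<gamma>'"],
        rule exI[of _ "\<lambda>k. if k = 1 then s else s'"], rule exI[of _ "\<lambda>k. if k = 1 then t else t'"])
      (use assms in auto)
  then show ?thesis by blast
qed

definition segment_curve :: "'n::finite mink \<Rightarrow> 'n mink \<Rightarrow> real \<Rightarrow> real \<Rightarrow> 'n mink" where
  "segment_curve z v c s = z + (c / 2 * s + c / 2) *\<^sub>R v"

lemma segment_curve_geodesic:
  assumes "lightlike v" "0 < c" "\<And>r. 0 < r \<Longrightarrow> r < c \<Longrightarrow> z + r *\<^sub>R v \<in> \<Omega>"
  shows "proj_lightlike_geodesic \<Omega> (segment_curve z v c)"
proof -
  have "0 < c / 2 * s + c / 2 \<and> c / 2 * s + c / 2 < c" if "s \<in> {-1<..<1}" for s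
  proof -
    have "0 < c * (1 + s)" "0 < c * (1 - s)" using that assms(2) by auto
    then show ?thesis by (simp add: algebra_simps)
  qed
  then show ?thesis
    unfolding proj_lightlike_geodesic_def segment_curve_def using assms
    by (intro exI[of _ z] exI[of _ v] exI[of _ "c / 2"] exI[of _ "c / 2"] exI[of _ 0] exI[of _ 1]) auto
qed

lemma segment_curve_param:
  assumes "0 < r" "r < c"
  shows "2 * r / c - 1 \<in> {-1<..<1}" "segment_curve z v c (2 * r / c - 1) = z + r *\<^sub>R v"
  using assms by (auto simp: segment_curve_def field_simps)

text \<open>On the segment of length \<open>c\<close>, \<open>rho\<close> measures the change of
  \<open>ln r - ln (c - r)\<close>. Dividing \<open>r\<close> by \<open>exp 1\<close> changes the
  first term by 1 and, as \<open>r \<le> c / 2\<close>, the second by at most \<open>ln 2\<close>.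
  The bound is uniform in \<open>r\<close> and \<open>c\<close>.\<close>

lemma markowitz_segment_step_le:
  assumes "lightlike v" "\<And>r. 0 < r \<Longrightarrow> r < c \<Longrightarrow> z + r *\<^sub>R v \<in> \<Omega>" "0 < r" "r \<le> c / 2"
  shows "markowitz \<Omega> (z + r *\<^sub>R v) (z + (r * exp (- 1)) *\<^sub>R v) \<le> 2"
proof -
  define r' where "r' = r * exp (- 1)"
  have "r * exp (-1) < r * 1" using assms(3) by (intro mult_strict_left_mono) auto
  then have r': "0 < r'" "r' < r" using assms(3) by (auto simp: r'_def)
  have c: "0 < c" "r < c" "r' < c" using assms r' by auto
  note s = segment_curve_param[OF assms(3) c(2)] and t = segment_curve_param[OF r'(1) c(3)]
  have lr': "ln r' = ln r - 1" using assms(3) by (simp add: r'_def ln_mult_pos)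
  have eq: "ln (1 + (2 * x / c - 1)) - ln (1 - (2 * x / c - 1)) = ln x - ln (c - x)" if "0 < x" "x < c" for x
  proof -
    have 1: "1 - (2 * x / c - 1) = 2 * (c - x) / c" "1 + (2 * x / c - 1) = 2 * x / c"
      using c by (simp_all add: field_simps)
    have 2: "ln (2 * y / c) = ln 2 + ln y - ln c" if "0 < y" for y
      using ln_div[of "2 * y" c] ln_mult_pos[of 2 y] that c by simp
    show ?thesis unfolding 1 using that by (simp add: 2 del: right_diff_distrib_numeral)
  qed
  have "rho (2 * r / c - 1) (2 * r' / c - 1) = \<bar>(ln r - ln (c - r)) - (ln r' - ln (c - r'))\<bar>"
    unfolding rho_eq[OF s(1) t(1)] eq[OF assms(3) c(2)] eq[OF r'(1) c(3)] ..
  also have "\<dots> = \<bar>1 + (ln (c - r') - ln (c - r))\<bar>" by (simp add: lr')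
  also have "\<dots> \<le> 2"
  proof -
    have "ln (c - r) \<le> ln (c - r')" using r' c by (intro ln_mono) auto
    moreover have "ln (c - r') \<le> ln (2 * (c - r))" using r' c assms(4) by (intro ln_mono) auto
    moreover have "ln (2 * (c - r)) = ln 2 + ln (c - r)" using c by (intro ln_mult_pos) auto
    moreover have "ln 2 \<le> (1::real)" using ln_le_minus_one[of "2::real"] by simp
    ultimately show ?thesis by linarith
  qed
  finally show ?thesis
    using markowitz_le_rho[OF segment_curve_geodesic[OF assms(1) c(1) assms(2)] s(1) t(1)]
    unfolding s(2) t(2) by (simp add: r'_def)
qed


section \<open>A large square near the tip of a lightlike segment\<close>

lemma mink_form_bilinear:
  "mink_form (x + y) z = mink_form x z + mink_form y z"
  "mink_form (x - y) z = mink_form x z - mink_form y z"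
  "mink_form z (x + y) = mink_form z x + mink_form z y"
  "mink_form z (x - y) = mink_form z x - mink_form z y"
  "mink_form (r *\<^sub>R x) z = r * mink_form x z"
  "mink_form z (r *\<^sub>R x) = r * mink_form z x"
  by (simp_all add: mink_form_def algebra_simps inner_simps)

lemma mink_form_commute: "mink_form x y = mink_form y x"
  by (simp add: mink_form_def inner_commute mult.commute)

text \<open>The coefficient of \<open>r\<close> squared is the Minkowski square of \<open>v\<close>,
  which is 0.\<close>

lemma null_affine_mink_form:
  fixes p :: "'n::finite mink"
  shows "null_affine (\<lambda>x. mink_form (x - p) (x - p) - k)"
  unfolding null_affine_def
proof (intro allI impI)
  fix x v :: "'n mink" assume "lightlike v"
  then have v: "mink_form v v = 0" by (simp add: lightlike_def)
  have eq: "x + r *\<^sub>R v - p = (x - p) + r *\<^sub>R v" for r by simp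
  have "mink_form (x + r *\<^sub>R v - p) (x + r *\<^sub>R v - p) - k
      = (mink_form (x - p) (x - p) - k) + (2 * mink_form (x - p) v) * r" for r
    unfolding eq mink_form_bilinear(1,3,5,6) mink_form_commute[of v "x - p"] v by simp
  then show "\<exists>A B. \<forall>r. mink_form (x + r *\<^sub>R v - p) (x + r *\<^sub>R v - p) - k = A + B * r" by blast
qed

lemma mink_form_neg_iff: "mink_form v v < 0 \<longleftrightarrow> norm (snd v) < \<bar>fst v\<bar>"
proof -
  have "fst v \<noteq> 0" if "snd v \<bullet> snd v < fst v * fst v"
    using that inner_ge_zero[of "snd v"] by (metis mult_zero_left not_le)
  then show ?thesis by (auto simp: mink_form_def norm_lt_square power2_eq_square)
qed

lemma mink_form_nonpos_iff: "mink_form v v \<le> 0 \<longleftrightarrow> norm (snd v) \<le> \<bar>fst v\<bar>"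
  using inner_self_le_iff_norm_le[of "\<bar>fst v\<bar>" "snd v"] by (simp add: mink_form_def)

text \<open>By compactness the Minkowski square of a difference attains its minimum on the closure;
  it is negative as \<open>\<Omega>\<close> contains vertical segments. A point of
  \<open>\<Omega>\<close> can still be moved vertically away from \<open>a\<close>, which lowers the
  square, so the inequality is strict on \<open>\<Omega>\<close>.\<close>

lemma timelike_diameter:
  fixes \<Omega> :: "'n::finite mink set"
  assumes "open \<Omega>" "bounded \<Omega>" "\<Omega> \<noteq> {}"
  obtains a b where "a \<in> closure \<Omega>" "b \<in> closure \<Omega>" "chron a b"
    "\<And>x. x \<in> \<Omega> \<Longrightarrow> mink_form (b - a) (b - a) < mink_form (x - a) (x - a)"
proof -
  let ?q = "\<lambda>v :: 'n mink. mink_form v v"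
  have K: "compact (closure \<Omega> \<times> closure \<Omega>)" using assms(2) by (intro compact_Times) auto
  have K0: "closure \<Omega> \<times> closure \<Omega> \<noteq> {}" using assms(3) by auto
  have cont: "continuous_on (closure \<Omega> \<times> closure \<Omega>) (\<lambda>z. ?q (snd z - fst z))"
    unfolding mink_form_def by (intro continuous_intros)
  obtain z where z: "z \<in> closure \<Omega> \<times> closure \<Omega>"
    "\<And>w. w \<in> closure \<Omega> \<times> closure \<Omega> \<Longrightarrow> ?q (snd z - fst z) \<le> ?q (snd w - fst w)"
    using continuous_attains_inf[OF K K0 cont] by blast
  have min: "?q (snd z - fst z) \<le> ?q (y - x)" if "x \<in> closure \<Omega>" "y \<in> closure \<Omega>" for x y
    using z(2)[of "(x, y)"] that by simp
  obtain x where x: "x \<in> \<Omega>" using assms(3) by blast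
  obtain s :: real where s: "0 < s" "x + (s, 0) \<in> \<Omega>" using open_time_shift[OF assms(1) x] by blast
  have neg: "?q (snd z - fst z) < 0"
  proof -
    have "?q (snd z - fst z) \<le> ?q ((x + (s, 0)) - x)"
      using x s closure_subset by (intro min) auto
    also have "\<dots> < 0" using s by (simp add: mink_form_def)
    finally show ?thesis .
  qed
  obtain a b where ab: "a \<in> closure \<Omega>" "b \<in> closure \<Omega>" "0 \<le> fst (b - a)"
    and q: "?q (b - a) = ?q (snd z - fst z)"
  proof (cases "0 \<le> fst (snd z - fst z)")
    case True then show thesis using that[of "fst z" "snd z"] z(1) by (auto simp: mem_Times_iff)
  next
    case False
    have "?q (fst z - snd z) = ?q (snd z - fst z)" by (simp add: mink_form_def algebra_simps)
    then show thesis using False that[of "snd z" "fst z"] z(1) by (auto simp: mem_Times_iff)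
  qed
  have "chron a b" using neg ab(3) unfolding q[symmetric] mink_form_neg_iff chron_def by simp
  moreover have "?q (b - a) < ?q (x - a)" if x: "x \<in> \<Omega>" for x
  proof -
    obtain s :: real where s: "0 < s" "x + (s, 0) \<in> \<Omega>" "x - (s, 0) \<in> \<Omega>"
      using open_time_shift[OF assms(1) x] by blast
    define e :: real where "e = (if 0 \<le> fst (x - a) then s else - s)"
    have eq: "x + (- s, 0) = x - (s, 0)" by (simp add: prod_eq_iff)
    have "x + (- s, 0) \<in> \<Omega>" unfolding eq by (rule s(3))
    then have "x + (e, 0) \<in> \<Omega>" using s(2) by (simp add: e_def)
    then have "?q (b - a) \<le> ?q ((x + (e, 0)) - a)"
      unfolding q using min[OF ab(1)] closure_subset by blast
    also have "\<dots> = ?q (x - a) - 2 * e * fst (x - a) - e * e"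
      by (simp add: mink_form_def algebra_simps)
    also have "\<dots> < ?q (x - a)"
    proof -
      have "0 \<le> e * fst (x - a)" using s(1) by (auto simp: e_def mult_le_0_iff)
      moreover have "0 < e * e" using s(1) by (auto simp: e_def)
      ultimately show ?thesis by linarith
    qed
    finally show ?thesis .
  qed
  ultimately show thesis using that[OF ab(1,2)] by blast
qed

theorem theoremD:
  fixes \<Omega> :: "'n::finite mink set"
  assumes "mink_domain \<Omega>" and "bounded \<Omega>" and "causally_convex \<Omega>"
    and "Gromov_hyperbolic \<Omega> (markowitz \<Omega>)"
  shows "\<not> C_maximal (mink_spacetime \<Omega>)"
proof
  assume cmax: "C_maximal (mink_spacetime \<Omega>)"
  have op: "open \<Omega>" and ne: "\<Omega> \<noteq> {}" using assms(1) by (auto simp: mink_domain_def)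
  obtain a b where a: "a \<in> closure \<Omega>" and b: "b \<in> closure \<Omega>" and ab: "chron a b"
    and amin: "\<And>x. x \<in> \<Omega> \<Longrightarrow> mink_form (b - a) (b - a) < mink_form (x - a) (x - a)"
    using timelike_diameter[OF op assms(2) ne] by blast
  have "b \<notin> \<Omega>" using amin by blast
  moreover have bF: "b \<in> chron_future \<Omega>"
    using a ab open_Int_closure_eq_empty[OF open_chron_below[of b], of \<Omega>]
    unfolding chron_future_def by blast
  ultimately obtain q where q: "causal_le q b" "q \<notin> chron_past \<Omega>" "q \<notin> chron_future \<Omega>"
    using C_maximal_edge[OF op assms(2,3) cmax] by blast
  \<comment> \<open>A point of \<open>\<Omega>\<close> causally related to \<open>q\<close> would
    put \<open>q\<close> into the chronological past or future of \<open>\<Omega>\<close>.\<close>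
  have qpos: "0 < mink_form (x - q) (x - q)" if x: "x \<in> \<Omega>" for x
  proof (rule ccontr)
    assume "\<not> 0 < mink_form (x - q) (x - q)"
    then have "norm (snd (x - q)) \<le> \<bar>fst (x - q)\<bar>" using mink_form_nonpos_iff[of "x - q"] by linarith
    then have "causal_le q x \<or> causal_le x q"
      using norm_minus_commute[of "snd x" "snd q"] by (auto simp: causal_le_def abs_if split: if_splits)
    moreover have "x \<in> chron_past \<Omega>" "x \<in> chron_future \<Omega>"
      using open_subset_chron_past[OF op] open_subset_chron_future[OF op] x by blast+
    ultimately show False using q chron_past_down chron_future_up by blast
  qed
  define U where "U = fst (b - q)"
  define p where "p = snd (b - q)"
  define u where "u = (U, p)"
  \<comment> \<open>The spatial reflection of \<open>u\<close> is a lightlike vector independent of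
    \<open>u\<close>.\<close>
  define w where "w = (U, - p)"
  \<comment> \<open>If \<open>q\<close> were chronologically below \<open>b\<close>, it would also
    be so below points of \<open>\<Omega>\<close> near \<open>b\<close>. Hence \<open>u\<close> is
    lightlike.\<close>
  have "\<not> chron q b"
    using b open_Int_closure_eq_empty[OF open_chron_above[of q], of \<Omega>] q(2) unfolding chron_past_def by blast
  then have pU: "norm p = U" using q(1) by (auto simp: chron_def causal_le_def U_def p_def)
  have ub: "u = b - q" by (simp add: u_def U_def p_def prod_eq_iff)
  have "b \<noteq> q" using bF q(3) by blast
  then have U: "0 < U" using causal_le_fst_less[OF q(1)] by (simp add: U_def)
  have pp: "p \<bullet> p = U * U" using pU by (metis power2_norm_eq_inner power2_eq_square)
  have uu: "mink_form u u = 0" "mink_form w w = 0" "mink_form u w = - 2 * (U * U)" "mink_form w u = - 2 * (U * U)"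
    using pp by (simp_all add: mink_form_def u_def w_def)
  have light: "lightlike (- u)" "lightlike (- w)"
    using U pp by (auto simp: lightlike_def mink_form_def u_def w_def prod_eq_iff)
  define X where "X = b - a"
  define \<alpha> where "\<alpha> = - mink_form X u"
  define \<beta> where "\<beta> = - mink_form X w"
  have X: "norm (snd X) < fst X" using ab by (simp add: X_def chron_def)
  have "\<bar>snd X \<bullet> p\<bar> < fst X * U"
    using Cauchy_Schwarz_ineq2[of "snd X" p] mult_strict_right_mono[OF X U] unfolding pU by linarith
  then have \<alpha>: "0 < \<alpha>" and \<beta>: "0 < \<beta>"
    by (auto simp: \<alpha>_def \<beta>_def mink_form_def u_def w_def)
  define G where "G \<tau> \<epsilon> = b - \<tau> *\<^sub>R u - \<epsilon> *\<^sub>R w" for \<tau> \<epsilon> :: real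
  \<comment> \<open>The summand 0 gives \<open>f\<close> the form of
    \<open>null_affine_mink_form\<close>.\<close>
  define f where "f x = mink_form (x - q) (x - q) - 0" for x
  define h where "h x = mink_form (x - a) (x - a) - mink_form X X" for x
  have naf: "null_affine f" and nah: "null_affine h"
    unfolding f_def h_def by (rule null_affine_mink_form)+
  have fpos: "0 < f x" and hpos: "0 < h x" if "x \<in> \<Omega>" for x
    using qpos[OF that] amin[OF that] by (simp_all add: f_def h_def X_def)
  have fG: "f (G \<tau> \<epsilon>) = 4 * (U * U) * (1 - \<tau>) * \<epsilon>" for \<tau> \<epsilon>
  proof -
    have "G \<tau> \<epsilon> - q = (1 - \<tau>) *\<^sub>R u - \<epsilon> *\<^sub>R w" unfolding G_def ub by (simp add: algebra_simps)
    then show ?thesis unfolding f_def by (simp add: mink_form_bilinear uu)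
  qed
  have hG: "h (G \<tau> \<epsilon>) = 2 * \<alpha> * \<tau> + \<epsilon> * (2 * \<beta> - 4 * (U * U) * \<tau>)" for \<tau> \<epsilon>
  proof -
    have eq: "G \<tau> \<epsilon> - a = X - \<tau> *\<^sub>R u - \<epsilon> *\<^sub>R w" unfolding G_def X_def by (simp add: algebra_simps)
    show ?thesis unfolding h_def eq \<alpha>_def \<beta>_def
      by (simp add: mink_form_bilinear uu mink_form_commute[of u X] mink_form_commute[of w X] algebra_simps)
  qed
  obtain \<delta> where \<delta>: "0 < \<delta>" "ball b \<delta> \<subseteq> {x. chron a x}"
    using ab open_chron_above[of a] open_contains_ball by blast
  define N where "N = norm u + norm w + 1"
  have N: "0 < N" by (simp add: N_def add_nonneg_pos)
  \<comment> \<open>For parameters below \<open>c\<close>, the three bounds keep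
    \<open>1 - \<tau>\<close> at least 1/2, \<open>G \<tau> \<epsilon>\<close> in the future of
    \<open>a\<close>, and the coefficient of \<open>\<epsilon>\<close> in \<open>hG\<close>
    nonnegative.\<close>
  define c where "c = min (1 / 2) (min (\<delta> / N) (\<beta> / (2 * (U * U))))"
  have c: "0 < c" "c \<le> 1 / 2" "c \<le> \<delta> / N" "c \<le> \<beta> / (2 * (U * U))"
    using \<delta>(1) N U \<beta> unfolding c_def by (simp, meson min.cobounded1 min.cobounded2 order_trans)+
  \<comment> \<open>The point lies chronologically between the closure points \<open>a\<close> and
    \<open>b\<close>, so causal convexity applies.\<close>
  have GO: "G \<tau> \<epsilon> \<in> \<Omega>" if te: "0 < \<tau>" "\<tau> < c" "0 < \<epsilon>" "\<epsilon> < c" for \<tau> \<epsilon>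
  proof -
    have "dist b (G \<tau> \<epsilon>) = norm (\<tau> *\<^sub>R u + \<epsilon> *\<^sub>R w)"
      by (simp add: dist_norm G_def add.commute)
    also have "\<dots> \<le> \<tau> * norm u + \<epsilon> * norm w"
      using norm_triangle_ineq[of "\<tau> *\<^sub>R u" "\<epsilon> *\<^sub>R w"] te by simp
    also have "\<dots> \<le> c * norm u + c * norm w" using te by (intro add_mono mult_right_mono) auto
    also have "\<dots> < c * N" using c(1) by (simp add: N_def algebra_simps)
    also have "\<dots> \<le> \<delta>" using c(3) N by (simp add: field_simps)
    finally have "chron a (G \<tau> \<epsilon>)" using \<delta>(2) by auto
    moreover have "chron (G \<tau> \<epsilon>) b"
    proof -
      have "b - G \<tau> \<epsilon> = ((\<tau> + \<epsilon>) * U, (\<tau> - \<epsilon>) *\<^sub>R p)"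
        by (simp add: G_def u_def w_def algebra_simps)
      moreover have "\<bar>\<tau> - \<epsilon>\<bar> * U < (\<tau> + \<epsilon>) * U" using te U by (intro mult_strict_right_mono) auto
      ultimately show ?thesis by (simp add: chron_def pU)
    qed
    ultimately show ?thesis
      using closure_chron_between[OF a b] causally_convexD[OF assms(3)] chron_imp_causal_le by blast
  qed
  \<comment> \<open>One step of \<open>k\<close> is one unit of \<open>- ln\<close>. The factor 1/2
    meets the condition \<open>r \<le> c / 2\<close> of
    \<open>markowitz_segment_step_le\<close>.\<close>
  define T where "T k = c / 2 * exp (- real k)" for k
  have T0: "0 < T k" for k using c(1) by (simp add: T_def)
  have Tc: "T k \<le> c / 2" for k
    using c(1) mult_left_mono[of "exp (- real k)" 1 "c / 2"] by (simp add: T_def)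
  have Tc': "T k < c" for k using Tc[of k] c(1) by linarith
  have TS: "T (Suc k) = T k * exp (- 1)" for k by (simp add: T_def exp_diff exp_minus field_simps exp_add)
  have lnT: "ln (T k) = ln (c / 2) - real k" for k
    using ln_mult_pos[of "c / 2" "exp (- real k)"] c(1) by (simp add: T_def)
  define C where "C = ln 2 + ln ((\<alpha> + \<beta>) / \<alpha>)"
  have C: "0 \<le> ln ((\<alpha> + \<beta>) / \<alpha>)" "(0::real) \<le> ln 2" using \<alpha> \<beta> by simp_all
  show False
  proof (rule Gromov_hyperbolic_no_quasi_flat[OF assms(4), of 2 C])
    fix n :: nat
    \<comment> \<open>The offset \<open>n\<close> ensures \<open>\<epsilon> \<le> \<tau>\<close> for
      all \<open>i \<le> n\<close>, the sector where \<open>h\<close> is comparable to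
      \<open>\<tau>\<close>.\<close>
    define g where "g i j = G (T i) (T (n + j))" for i j
    have gO: "g i j \<in> \<Omega>" for i j unfolding g_def using GO T0 Tc' by blast
    have Gu: "G \<tau> \<epsilon> = (b - \<epsilon> *\<^sub>R w) + \<tau> *\<^sub>R (- u)" and Gw: "G \<tau> \<epsilon> = (b - \<tau> *\<^sub>R u) + \<epsilon> *\<^sub>R (- w)" for \<tau> \<epsilon>
      by (simp_all add: G_def)
    have Gu\<Omega>: "(b - T k *\<^sub>R w) + r *\<^sub>R (- u) \<in> \<Omega>" if "0 < r" "r < c" for k r
      using GO[OF that T0[of k] Tc'[of k]] by (simp add: Gu)
    have Gw\<Omega>: "(b - T k *\<^sub>R u) + r *\<^sub>R (- w) \<in> \<Omega>" if "0 < r" "r < c" for k r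
      using GO[OF T0[of k] Tc'[of k] that] by (simp add: Gw)
    have stepi: "markowitz \<Omega> (g i j) (g (Suc i) j) \<le> 2" for i j
      unfolding g_def TS Gu by (rule markowitz_segment_step_le[OF light(1) Gu\<Omega> T0 Tc])
    have stepj: "markowitz \<Omega> (g i j) (g i (Suc j)) \<le> 2" for i j
      unfolding g_def add_Suc_right TS Gw by (rule markowitz_segment_step_le[OF light(2) Gw\<Omega> T0 Tc])
    \<comment> \<open>Two segments suffice: along \<open>u\<close> from \<open>g i j\<close> to
      \<open>g i' j\<close>, then along \<open>w\<close> to \<open>g i' j'\<close>.\<close>
    have ne: "chain_lengths \<Omega> (g i j) (g i' j') \<noteq> {}" for i j i' j'
    proof -
      define \<gamma> where "\<gamma> = segment_curve (b - T (n + j) *\<^sub>R w) (- u) c"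
      define \<gamma>' where "\<gamma>' = segment_curve (b - T i' *\<^sub>R u) (- w) c"
      have \<gamma>: "proj_lightlike_geodesic \<Omega> \<gamma>"
        unfolding \<gamma>_def by (rule segment_curve_geodesic[OF light(1) c(1) Gu\<Omega>])
      have \<gamma>': "proj_lightlike_geodesic \<Omega> \<gamma>'"
        unfolding \<gamma>'_def by (rule segment_curve_geodesic[OF light(2) c(1) Gw\<Omega>])
      have I: "2 * T k / c - 1 \<in> {-1<..<1}" for k using segment_curve_param(1)[OF T0 Tc'] .
      have e: "\<gamma> (2 * T k / c - 1) = g k j" "\<gamma>' (2 * T (n + k) / c - 1) = g i' k" for k
        unfolding \<gamma>_def \<gamma>'_def g_def segment_curve_param(2)[OF T0 Tc'] by (simp_all add: G_def)
      show ?thesis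
        using chain_lengths_two_ne[OF \<gamma> I[of i] I[of i'] \<gamma>' I[of "n + j"] I[of "n + j'"]]
        unfolding e by blast
    qed
    have lower: "\<bar>real i - real i'\<bar> \<le> markowitz \<Omega> (g i j) (g i' j') + C \<and>
        \<bar>real j - real j'\<bar> \<le> markowitz \<Omega> (g i j) (g i' j') + C" if ii: "i \<le> n" "i' \<le> n" for i j i' j'
    proof -
      \<comment> \<open>The factor \<open>T (n + j)\<close> of \<open>f\<close> contributes
        \<open>- j\<close> up to a constant; the factor \<open>1 - T i\<close> lies between 1/2 and
        1, an error of at most \<open>ln 2\<close>.\<close>
      have lf: "ln (f (g i j)) = ln (4 * (U * U)) + ln (1 - T i) + ln (c / 2) - real n - real j"
        and lf1: "- ln 2 \<le> ln (1 - T i)" "ln (1 - T i) \<le> 0" for i j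
      proof -
        have t: "1 / 2 \<le> 1 - T i" "1 - T i \<le> 1" using T0[of i] Tc[of i] c(2) by linarith+
        have "ln (1 / 2) \<le> ln (1 - T i)" using t by (intro ln_mono) auto
        then show "- ln 2 \<le> ln (1 - T i)" by (simp add: ln_div)
        show "ln (1 - T i) \<le> 0" using t by simp
        have "ln (f (g i j)) = ln (4 * (U * U)) + ln (1 - T i) + ln (T (n + j))"
          unfolding g_def fG using U t T0[of "n + j"]
          by (subst ln_mult_pos, simp, simp, subst ln_mult_pos) auto
        then show "ln (f (g i j)) = ln (4 * (U * U)) + ln (1 - T i) + ln (c / 2) - real n - real j"
          by (simp add: lnT)
      qed
      \<comment> \<open>For \<open>\<epsilon> \<le> \<tau>\<close> the second summand in
        \<open>hG\<close> lies between 0 and \<open>2 * \<beta> * \<tau>\<close>, so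
        \<open>h\<close> is \<open>2 * \<alpha> * \<tau>\<close> up to a factor between 1 and
        \<open>(\<alpha> + \<beta>) / \<alpha>\<close>.\<close>
      have lh: "ln (2 * \<alpha>) + ln (c / 2) - real i \<le> ln (h (g i j))"
        "ln (h (g i j)) \<le> ln (2 * \<alpha>) + ln (c / 2) - real i + ln ((\<alpha> + \<beta>) / \<alpha>)" if "i \<le> n" for i j
      proof -
        have le: "T (n + j) \<le> T i" using that c(1) by (simp add: T_def)
        have "c * (2 * (U * U)) \<le> \<beta>" using c(4) U by (simp add: field_simps)
        moreover have "T i * (2 * (U * U)) \<le> c * (2 * (U * U))"
          using Tc'[of i] U by (intro mult_right_mono) auto
        ultimately have t: "0 \<le> 2 * \<beta> - 4 * (U * U) * T i" using \<beta> by (simp add: algebra_simps)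
        have 1: "2 * \<alpha> * T i \<le> h (g i j)" unfolding g_def hG using t T0[of "n + j"] by simp
        have "ln (2 * \<alpha> * T i) \<le> ln (h (g i j))" using 1 \<alpha> T0[of i] by (intro ln_mono) auto
        moreover have "ln (2 * \<alpha> * T i) = ln (2 * \<alpha>) + ln (T i)" using \<alpha> T0 by (intro ln_mult_pos) auto
        ultimately show "ln (2 * \<alpha>) + ln (c / 2) - real i \<le> ln (h (g i j))" by (simp add: lnT)
        have "T (n + j) * (2 * \<beta> - 4 * (U * U) * T i) \<le> T i * (2 * \<beta>)"
          using le t T0[of i] U by (intro mult_mono) auto
        moreover have r: "2 * \<alpha> * T i * ((\<alpha> + \<beta>) / \<alpha>) = 2 * \<alpha> * T i + T i * (2 * \<beta>)"
          using \<alpha> by (simp add: field_simps)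
        ultimately have "h (g i j) \<le> 2 * \<alpha> * T i * ((\<alpha> + \<beta>) / \<alpha>)"
          unfolding g_def hG r by linarith
        then have "ln (h (g i j)) \<le> ln (2 * \<alpha> * T i * ((\<alpha> + \<beta>) / \<alpha>))"
          using hpos[OF gO] by (intro ln_mono) auto
        also have "\<dots> = ln (2 * \<alpha> * T i) + ln ((\<alpha> + \<beta>) / \<alpha>)"
          using \<alpha> \<beta> T0 by (intro ln_mult_pos) auto
        finally show "ln (h (g i j)) \<le> ln (2 * \<alpha>) + ln (c / 2) - real i + ln ((\<alpha> + \<beta>) / \<alpha>)"
          using \<open>ln (2 * \<alpha> * T i) = ln (2 * \<alpha>) + ln (T i)\<close> by (simp add: lnT)
      qed
      have mf: "\<bar>ln (f (g i j)) - ln (f (g i' j'))\<bar> \<le> markowitz \<Omega> (g i j) (g i' j')"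
        by (rule markowitz_ge[OF naf fpos gO gO ne])
      have mh: "\<bar>ln (h (g i j)) - ln (h (g i' j'))\<bar> \<le> markowitz \<Omega> (g i j) (g i' j')"
        by (rule markowitz_ge[OF nah hpos gO gO ne])
      have "\<bar>real i - real i'\<bar> \<le> markowitz \<Omega> (g i j) (g i' j') + C"
        using mh lh[OF ii(1), of j] lh[OF ii(2), of j'] C unfolding C_def by linarith
      moreover have "\<bar>real j - real j'\<bar> \<le> markowitz \<Omega> (g i j) (g i' j') + C"
        using mf lf1[of i] lf1[of i'] C unfolding C_def lf by linarith
      ultimately show ?thesis ..
    qed
    show "\<exists>g. (\<forall>i\<le>n. \<forall>j\<le>n. g i j \<in> \<Omega>) \<and>
      (\<forall>i<n. \<forall>j\<le>n. markowitz \<Omega> (g i j) (g (Suc i) j) \<le> 2) \<and>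
      (\<forall>i\<le>n. \<forall>j<n. markowitz \<Omega> (g i j) (g i (Suc j)) \<le> 2) \<and>
      (\<forall>i\<le>n. \<forall>j\<le>n. \<forall>i'\<le>n. \<forall>j'\<le>n. \<bar>real i - real i'\<bar> \<le> markowitz \<Omega> (g i j) (g i' j') + C \<and>
         \<bar>real j - real j'\<bar> \<le> markowitz \<Omega> (g i j) (g i' j') + C)"
      by (rule exI[of _ g]) (use gO stepi stepj lower in simp)
  qed (use C in \<open>simp_all add: C_def\<close>)
qed

end
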